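(* With the spheres $\mathbf{S}^2_{\mathrm{I}},\mathbf{S}^2_{\mathrm{II}},\mathbf{S}^2_{\mathrm{III}}$ and the Lagrange spectra $\mathscr{L}(\mathcal X,\mathcal Z)$ defined in the context, $$\mathscr{L}(\mathbf S^2_{\mathrm{I}},\mathbf S^2_{\mathrm{I}}\cap\mathbb{Q}^3)=\tfrac1{\sqrt2}\,\mathscr{L}(\mathbb{C},\mathbb{Q}(\sqrt{-1})),$$ $$\mathscr{L}(\mathbf S^2_{\mathrm{II}},\mathbf S^2_{\mathrm{II}}\cap\mathbb{Q}^3)=\tfrac1{\sqrt2}\,\mathscr{L}(\mathbb{C},\mathbb{Q}(\sqrt{-2})),$$ $$\mathscr{L}(\mathbf S^2_{\mathrm{III}},\mathbf S^2_{\mathrm{III}}\cap\mathbb{Q}^4)=\tfrac1{\sqrt2}\,\mathscr{L}(\mathbb{C},\mathbb{Q}(\sqrt{-3})).$$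
   Context: Lagrange numbers and spectra. Let $(\mathcal X,\mathrm d)$ be a complete metric space, $\mathcal Z\subset\mathcal X$ a countable dense subset, and $\mathrm{Ht}_{\mathcal Z}:\mathcal Z\to\mathbb{R}_{\ge0}$ a height function. For $P\in\mathcal X\setminus\mathcal Z$, $$L_{(\mathcal X,\mathcal Z)}(P)=\limsup_{Z\in\mathcal Z}\frac{1}{\mathrm{Ht}_{\mathcal Z}(Z)\,\mathrm d(P,Z)}\in[0,\infty],$$ where the limsup over the countable set $\mathcal Z$ is $\inf_{F\subset\mathcal Z\text{ finite}}\ \sup_{Z\in\mathcal Z\setminus F}$ (equivalently, the supremum of those $L\ge 0$ for which $\mathrm d(P,Z)<1/(L\,\mathrm{Ht}_{\mathcal Z}(Z))$ has infinitely many solutions $Z\in\mathcal Z$). The Lagrange spectrum is $$\mathscr{L}(\mathcal X,\mathcal Z)=\{L_{(\mathcal X,\mathcal Z)}(P): P\in\mathcal X\setminus\mathcal Z,\ L_{(\mathcal X,\mathcal Z)}(P)>0\}.$$ For $c>0$ and a set $A$, $cA=\{ca:a\in A\}$ (with $c\cdot\infty=\infty$). Spheres. $\mathbf{S}^2_{\mathrm{I}}=\{(x_1,x_2,x_3)\in\mathbb{R}^3: x_1^2+x_2^2+x_3^2=1\}$; $\mathbf{S}^2_{\mathrm{II}}=\{(x_1,x_2,x_3)\in\mathbb{R}^3: x_1^2+x_2^2+x_3^2=2\}$; $\mathbf{S}^2_{\mathrm{III}}=\{(x_0,x_1,x_2,x_3)\in\mathbb{R}^4: x_0+x_1+x_2+x_3=1,\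 x_0^2+x_1^2+x_2^2+x_3^2=1\}$. The distance on each is the Euclidean distance of the ambient $\mathbb{R}^l$ ($l=3,3,4$). The height of a rational point is $\mathrm{Ht}(\mathbf p/q)=|q|$, where $\mathbf p\in\mathbb{Z}^l$ is primitive (its coordinates have no common divisor $>1$) and $q$ is a nonzero integer (on these spheres this is equivalent to requiring that the coordinates of $\mathbf p$ together with $q$ have gcd $1$). Complex plane. The distance on $\mathbb{C}$ is $|z-w|$. For $K=\mathbb{Q}(\sqrt{-1}),\mathbb{Q}(\sqrt{-2}),\mathbb{Q}(\sqrt{-3})$, viewed as a subset of $\mathbb{C}$, with ring of integers $\mathcal O_K$ (of class number one), write $z\in K$ as $z=\alpha/\beta$ with $\alpha,\beta\in\mathcal O_K$ generating the unit ideal $\mathcal O_K$; the height is $\mathrm{Ht}_K(z)=|\beta|^2$ (well defined, since $\alpha/\beta$ is unique up to a unit). *)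

theory Defs
  imports "HOL-Analysis.Analysis" "HOL-Computational_Algebra.Polynomial"
begin

section \<open>Lagrange numbers and Lagrange spectra\<close>

text \<open>
  The space \<open>X\<close> is a subset of a type of class \<^class>\<open>metric_space\<close>, with the induced distance;
  \<open>Ht\<close> only matters on \<open>Z\<close>. The limsup is the infimum over finite \<open>F \<subseteq> Z\<close> of the
  supremum over \<open>Z - F\<close>, computed in \<^typ>\<open>ennreal\<close>, where \<open>1 / 0 = \<infinity>\<close>.
\<close>

definition lagrange_number :: "'a::metric_space set \<Rightarrow> ('a \<Rightarrow> real) \<Rightarrow> 'a \<Rightarrow> ennreal" where
  "lagrange_number Z Ht P =
     (INF F\<in>{F. finite F \<and> F \<subseteq> Z}. SUP z\<in>Z - F. 1 / ennreal (Ht z * dist P z))"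

definition lagrange_spectrum ::
    "'a::metric_space set \<Rightarrow> 'a set \<Rightarrow> ('a \<Rightarrow> real) \<Rightarrow> ennreal set" where
  "lagrange_spectrum X Z Ht =
     {lagrange_number Z Ht P | P. P \<in> X - Z \<and> lagrange_number Z Ht P > 0}"

definition scale_set :: "real \<Rightarrow> ennreal set \<Rightarrow> ennreal set" where
  "scale_set c A = (\<lambda>a. ennreal c * a) ` A"


section \<open>Spheres and their rational points\<close>

definition sphere_I :: "(real ^ 3) set" where
  "sphere_I = {x. (x $ 1)\<^sup>2 + (x $ 2)\<^sup>2 + (x $ 3)\<^sup>2 = 1}"

definition sphere_II :: "(real ^ 3) set" where
  "sphere_II = {x. (x $ 1)\<^sup>2 + (x $ 2)\<^sup>2 + (x $ 3)\<^sup>2 = 2}"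

definition sphere_III :: "(real ^ 4) set" where
  "sphere_III = {x. x $ 0 + x $ 1 + x $ 2 + x $ 3 = 1 \<and>
     (x $ 0)\<^sup>2 + (x $ 1)\<^sup>2 + (x $ 2)\<^sup>2 + (x $ 3)\<^sup>2 = 1}"

definition rational_points :: "(real ^ 'n) set" where
  "rational_points = {x. \<forall>i. x $ i \<in> \<rat>}"

text \<open>
  A nonzero vector has at most one height. A rational vector need not have a representation with
  primitive numerator, e.g. \<open>(2, 0, 0)\<close>, but every rational point of the three spheres does.
\<close>

definition rational_height :: "real ^ 'n \<Rightarrow> real" where
  "rational_height x = (THE h. \<exists>(p :: int ^ 'n) (q :: int).
     Gcd (range (($) p)) = 1 \<and> q \<noteq> 0 \<and>
     x = (\<chi> i. of_int (p $ i) / of_int q) \<and> h = \<bar>of_int q\<bar>)"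


section \<open>Quadratic fields in the complex plane\<close>

text \<open>\<open>quadratic_field D\<close> is the subfield of the complex numbers generated by a square root of \<open>D\<close>.\<close>

definition quadratic_field :: "int \<Rightarrow> complex set" where
  "quadratic_field D = {of_rat a + of_rat b * csqrt (of_int D) | a b. True}"

definition ring_of_integers :: "complex set \<Rightarrow> complex set" where
  "ring_of_integers K = {z \<in> K. algebraic_int z}"

definition generate_unit_ideal :: "complex set \<Rightarrow> complex \<Rightarrow> complex \<Rightarrow> bool" where
  "generate_unit_ideal R \<alpha> \<beta> \<longleftrightarrow> {\<alpha> * \<gamma> + \<beta> * \<delta> | \<gamma> \<delta>. \<gamma> \<in> R \<and> \<delta> \<in> R} = R"

text \<open>
  For imaginary quadratic \<open>K\<close> all units of the ring of integers have modulus 1, so the height does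
  not depend on the representation; existence of a representation uses class number one.
  The condition \<open>\<beta> \<noteq> 0\<close> is needed because \<open>1 / 0 = 0\<close> in HOL.
\<close>

definition field_height :: "complex set \<Rightarrow> complex \<Rightarrow> real" where
  "field_height K z = (THE h. \<exists>\<alpha>\<in>ring_of_integers K. \<exists>\<beta>\<in>ring_of_integers K.
     \<beta> \<noteq> 0 \<and> generate_unit_ideal (ring_of_integers K) \<alpha> \<beta> \<and>
     z = \<alpha> / \<beta> \<and> h = (cmod \<beta>)\<^sup>2)"

end

theory Submission
  imports Defs
begin

text \<open>
  Let \<open>K\<close> be one of the three fields and \<open>\<O>\<close> its ring of integers, which is Euclidean. A coprime pair
  \<open>(\<alpha>, \<beta>)\<close> defines the integral Hermitian matrix of rank one with entries \<open>\<bar>\<alpha>\<bar>\<^sup>2\<close>, \<open>\<bar>\<beta>\<bar>\<^sup>2\<close> and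
  \<open>\<alpha> * cnj \<beta>\<close>. The lattice of Hermitian matrices over \<open>\<O>\<close> with twice the determinant is isometric
  to the even sublattice of the integral light cone form of the sphere, and this sublattice contains
  all integral null vectors. Hence rational points of the sphere correspond to points \<open>z = \<alpha> / \<beta>\<close> of
  \<open>K\<close> (and \<open>\<infinity>\<close>), and the height of the point is \<open>h(\<alpha>, \<beta>) = \<bar>\<beta>\<bar>\<^sup>2 * h(z)\<close> for a positive definite
  Hermitian form \<open>h\<close>. The same isometry gives \<open>dist (g z) (g w)\<^sup>2 = 2 * \<bar>z - w\<bar>\<^sup>2 / (h(z) * h(w))\<close>, so that
  \<open>Ht (g z) * dist (g P) (g z) = sqrt 2 * (\<bar>\<beta>\<bar>\<^sup>2 * \<bar>P - z\<bar>) * sqrt (h(z) / h(P))\<close>, whose last factor tends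
  to 1 as \<open>z\<close> approaches \<open>P\<close>.
\<close>

section \<open>Lagrange numbers under conformal maps\<close>

lemma ennreal_inverse_antimono: "a \<le> b \<Longrightarrow> inverse b \<le> inverse (a::ennreal)"
  by (simp add: less_eq_ennreal.rep_eq inverse_ennreal.rep_eq ereal_inverse_antimono)

text \<open>A finite \<open>F\<close> whose supremum stays below \<open>y\<close> contains every
  such \<open>z\<close>, because the term of \<open>z\<close> is at least \<open>y\<close>.
  Truncation by \<open>ennreal\<close> is harmless: a nonpositive product gives the term
  infinity.\<close>

lemma finite_of_lagrange_number_less:
  assumes "lagrange_number Z Ht P < ennreal y" "y > 0"
  shows "finite {z\<in>Z. Ht z * dist P z \<le> 1 / y}"
proof -
  obtain F where F: "finite F" "(SUP z\<in>Z - F. 1 / ennreal (Ht z * dist P z)) < ennreal y"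
    using assms(1) unfolding lagrange_number_def INF_less_iff by blast
  have "z \<in> F" if "z \<in> Z" "Ht z * dist P z \<le> 1 / y" for z
  proof (rule ccontr)
    assume "z \<notin> F"
    then have "1 / ennreal (Ht z * dist P z) < ennreal y"
      using F(2) that(1) by (intro le_less_trans[OF SUP_upper F(2)]) auto
    moreover have "1 / ennreal (1 / y) \<le> 1 / ennreal (Ht z * dist P z)"
      unfolding divide_ennreal_def
      using that(2) by (intro mult_left_mono) (auto intro!: ennreal_inverse_antimono ennreal_leI)
    moreover have "1 / ennreal (1 / y) = ennreal y"
      using assms(2) by (metis divide_ennreal ennreal_1 one_divide_one_divide_ennreal zero_le_one)
    ultimately show False by simp
  qed
  then show ?thesis
    by (intro finite_subset[OF _ F(1)]) auto
qed

text \<open>The finite set in the hypothesis is itself an admissible \<open>F\<close>, and outside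
  it every term is at most \<open>y\<close>. Density of \<open>ennreal\<close> then lets
  \<open>y\<close> descend to \<open>x\<close>.\<close>

lemma lagrange_number_leI:
  assumes "\<And>y. 0 < y \<Longrightarrow> x < ennreal y \<Longrightarrow> finite {z\<in>Z. Ht z * dist P z < 1 / y}"
  shows "lagrange_number Z Ht P \<le> x"
proof (rule dense_ge)
  fix u assume u: "x < u"
  show "lagrange_number Z Ht P \<le> u"
  proof (cases u)
    case (real y)
    have y: "y > 0" using u real
      by (metis ennreal_0 linorder_not_le not_less_zero order_le_less)
    have "1 / ennreal (Ht z * dist P z) \<le> ennreal y" if "\<not> Ht z * dist P z < 1 / y" for z
    proof -
      have "1 / ennreal (Ht z * dist P z) \<le> 1 / ennreal (1 / y)"
        unfolding divide_ennreal_def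
        using that by (intro mult_left_mono) (auto intro!: ennreal_inverse_antimono ennreal_leI)
      also have "\<dots> = ennreal y"
        using y by (metis divide_ennreal ennreal_1 one_divide_one_divide_ennreal zero_le_one)
      finally show ?thesis .
    qed
    then show ?thesis
      unfolding lagrange_number_def real
      using assms[OF y] u real
      by (intro INF_lower2[where i = "{z\<in>Z. Ht z * dist P z < 1 / y}"] SUP_least) auto
  qed simp
qed

text \<open>Up to finitely many exceptions \<open>\<phi>\<close> worsens an approximation by at most
  the factor \<open>k * c\<close>. As \<open>k > 1\<close> is arbitrary, only \<open>c\<close>
  survives in the limsup. Injectivity off \<open>F\<close> turns infinitely many approximations of
  \<open>P1\<close> into infinitely many of \<open>P2\<close>.\<close>

lemma lagrange_number_le_of_embedding:
  assumes c: "c > 0" and F: "finite F" and inj: "inj_on \<phi> (Z1 - F)"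
    and cmp: "\<And>k t. k > 1 \<Longrightarrow> t > 0 \<Longrightarrow> finite {z\<in>Z1. Ht1 z * dist P1 z < t \<and>
      \<not> (\<phi> z \<in> Z2 \<and> Ht2 (\<phi> z) * dist P2 (\<phi> z) \<le> k * (c * (Ht1 z * dist P1 z)))}"
  shows "lagrange_number Z1 Ht1 P1 \<le> ennreal c * lagrange_number Z2 Ht2 P2"
proof (rule lagrange_number_leI)
  fix y :: real assume y: "y > 0" and "ennreal c * lagrange_number Z2 Ht2 P2 < ennreal y"
  then obtain l where l: "lagrange_number Z2 Ht2 P2 = ennreal l" "l \<ge> 0"
    using c by (cases "lagrange_number Z2 Ht2 P2") (auto simp: ennreal_mult_top)
  have less: "c * l < y"
    using \<open>ennreal c * _ < _\<close> y c l by (simp add: ennreal_mult[symmetric] ennreal_less_iff)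
  \<comment> \<open>With this \<open>k\<close> the threshold \<open>y / (c * k)\<close> is the
    midpoint of \<open>l\<close> and \<open>y / c\<close>, hence still above
    \<open>l\<close>.\<close>
  define k where "k = 2 * y / (y + c * l)"
  have pos: "y + c * l > 0" using y c l by (simp add: add_pos_nonneg)
  have k: "k > 1" using less pos by (simp add: k_def field_simps)
  have eq: "y / (c * k) = (y / c + l) / 2" using c y pos by (simp add: k_def field_simps)
  have "l < y / (c * k)" using less c by (simp add: eq field_simps)
  then have fin2: "finite {z\<in>Z2. Ht2 z * dist P2 z \<le> 1 / (y / (c * k))}"
    using l y c k by (intro finite_of_lagrange_number_less) (auto simp: ennreal_less_iff)
  let ?B = "{z\<in>Z1. Ht1 z * dist P1 z < 1 / y \<and>
      \<not> (\<phi> z \<in> Z2 \<and> Ht2 (\<phi> z) * dist P2 (\<phi> z) \<le> k * (c * (Ht1 z * dist P1 z)))}"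
  let ?G = "{z\<in>Z1 - F. \<phi> z \<in> Z2 \<and> Ht2 (\<phi> z) * dist P2 (\<phi> z) \<le> 1 / (y / (c * k))}"
  have "finite ?G"
    by (rule finite_imageD[OF finite_subset[OF _ fin2]]) (auto intro: inj_on_subset[OF inj])
  moreover have "finite ?B" using cmp[OF k, of "1 / y"] y by simp
  moreover have "{z\<in>Z1. Ht1 z * dist P1 z < 1 / y} \<subseteq> F \<union> ?B \<union> ?G"
  proof safe
    fix z assume z: "z \<in> Z1" "Ht1 z * dist P1 z < 1 / y" "z \<notin> F" "\<phi> z \<in> Z2"
      and nG: "\<not> Ht2 (\<phi> z) * dist P2 (\<phi> z) \<le> 1 / (y / (c * k))"
      and *: "Ht2 (\<phi> z) * dist P2 (\<phi> z) \<le> k * (c * (Ht1 z * dist P1 z))"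
    have "k * (c * (Ht1 z * dist P1 z)) \<le> k * (c * (1 / y))"
      using z c k by (intro mult_left_mono) auto
    then show False using nG * by (simp add: mult_ac)
  qed
  ultimately show "finite {z\<in>Z1. Ht1 z * dist P1 z < 1 / y}"
    using F by (meson finite_UnI finite_subset)
qed

text \<open>
  The conformal factor \<open>sqrt (h z / h P)\<close> between \<open>Ht' (g z) * dist (g P) (g z)\<close> and
  \<open>sqrt 2 * (Ht z * dist P z)\<close> tends to 1 at \<open>P\<close>, while points of \<open>K\<close> away from \<open>P\<close> do not
  influence the limsup.
\<close>

lemma lagrange_spectrum_conformal:
  fixes K :: "complex set" and g :: "complex \<Rightarrow> 'a::metric_space"
  assumes ht: "\<And>z. z \<in> K \<Longrightarrow> 1 \<le> ht z"
    and fin: "\<And>B. finite {z\<in>K. ht z \<le> B \<and> cmod z \<le> B}"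
    and m: "m > 0" and h_low: "\<And>z. m * (1 + (cmod z)\<^sup>2) \<le> h z"
    and h_cont: "continuous_on UNIV h"
    and dist_g: "\<And>z w. (dist (g z) (g w))\<^sup>2 = 2 * (cmod (z - w))\<^sup>2 / (h z * h w)"
    and ht_g: "\<And>z. z \<in> K \<Longrightarrow> Ht (g z) = ht z * h z"
    and X: "range g = X - {N}" and Z: "g ` K = Z - {N}" "N \<in> Z"
  shows "lagrange_spectrum X Z Ht = scale_set (1 / sqrt 2) (lagrange_spectrum UNIV K ht)"
proof -
  have hm: "h z \<ge> m" for z
    using h_low[of z] m by (smt (verit, best) mult_less_cancel_left2 zero_le_power2)
  have hpos: "h z > 0" for z using hm[of z] m by linarith
  have dist_eq: "dist (g z) (g w) = sqrt 2 * cmod (z - w) / (sqrt (h z) * sqrt (h w))" for z w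
  proof -
    have "dist (g z) (g w) = sqrt ((dist (g z) (g w))\<^sup>2)" by simp
    then show ?thesis unfolding dist_g by (simp add: real_sqrt_divide real_sqrt_mult)
  qed
  have inj: "inj g"
  proof (rule injI)
    fix z w assume "g z = g w"
    then show "z = w" using dist_eq[of z w] hpos[of z] hpos[of w] by simp
  qed
  have L: "lagrange_number Z Ht (g P) = ennreal (1 / sqrt 2) * lagrange_number K ht P" for P
  proof (rule antisym)
    have near: "\<exists>\<delta>>0. \<forall>z. cmod (P - z) < \<delta> \<longrightarrow> \<bar>h z - h P\<bar> < e" if "e > 0" for e
      using h_cont that unfolding continuous_on_iff
      by (simp add: dist_norm norm_minus_commute[of P])
    have prod: "ht z * h z * dist (g P) (g z) = sqrt 2 * ht z * cmod (P - z) * sqrt (h z / h P)" for z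
    proof -
      have "sqrt (h z) * sqrt (h z) = h z" using hpos[of z] by simp
      then show ?thesis using hpos[of z] hpos[of P]
        by (simp add: dist_eq real_sqrt_divide field_simps)
    qed
    have "lagrange_number K ht P \<le> ennreal (sqrt 2) * lagrange_number Z Ht (g P)"
    proof (rule lagrange_number_le_of_embedding[where F = "{}" and \<phi> = g])
      fix k t :: real assume k: "k > 1" and t: "t > 0"
      \<comment> \<open>Within \<open>\<delta>\<close> of \<open>P\<close> this tolerance gives
        \<open>h z \<le> k\<^sup>2 * h P\<close>, so the conformal factor is at most
        \<open>k\<close> there.\<close>
      have "(k\<^sup>2 - 1) * h P > 0" using k hpos[of P] by simp
      from near[OF this] obtain \<delta> where \<delta>: "\<delta> > 0"
        "\<And>z. cmod (P - z) < \<delta> \<Longrightarrow> \<bar>h z - h P\<bar> < (k\<^sup>2 - 1) * h P" by blast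
      show "finite {z \<in> K. ht z * dist P z < t \<and>
             \<not> (g z \<in> Z \<and> Ht (g z) * dist (g P) (g z) \<le> k * (sqrt 2 * (ht z * dist P z)))}"
      \<comment> \<open>An exception has distance at least \<open>\<delta>\<close> from
        \<open>P\<close>, so its height is below \<open>t / \<delta>\<close>; since heights are at
        least 1, its distance is also below \<open>t\<close>.\<close>
      proof (rule finite_subset[OF _ fin[of "max (t / \<delta>) (cmod P + t)"]], rule subsetI)
        fix z assume "z \<in> {z \<in> K. ht z * dist P z < t \<and>
             \<not> (g z \<in> Z \<and> Ht (g z) * dist (g P) (g z) \<le> k * (sqrt 2 * (ht z * dist P z)))}"
        then have z: "z \<in> K" "ht z * dist P z < t"
          and *: "\<not> Ht (g z) * dist (g P) (g z) \<le> k * (sqrt 2 * (ht z * dist P z))"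
          using Z by auto
        have "cmod (P - z) \<le> ht z * cmod (P - z)"
          using ht[OF z(1)] by (simp add: mult_le_cancel_right1)
        then have "cmod (P - z) < t" using z(2) by (simp add: dist_norm)
        then have zb: "cmod z \<le> cmod P + t"
          using norm_triangle_ineq2[of z P] by (simp add: norm_minus_commute)
        have "\<not> cmod (P - z) < \<delta>"
        proof
          assume "cmod (P - z) < \<delta>"
          then have "h z \<le> k\<^sup>2 * h P" using \<delta>(2)[of z] by (simp add: algebra_simps abs_if split: if_splits)
          then have "sqrt (h z / h P) \<le> k"
            using hpos[of P] k by (intro real_le_lsqrt) (auto simp: field_simps)
          then have "(sqrt 2 * ht z * cmod (P - z)) * sqrt (h z / h P) \<le> (sqrt 2 * ht z * cmod (P - z)) * k"
            using ht[OF z(1)] by (intro mult_left_mono) auto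
          then show False using * unfolding ht_g[OF z(1)] prod dist_norm by (simp add: mult_ac)
        qed
        then have "ht z * \<delta> \<le> ht z * cmod (P - z)" using ht[OF z(1)] by (intro mult_left_mono) auto
        then have "ht z * \<delta> < t" using z(2) by (simp add: dist_norm)
        then have "ht z < t / \<delta>" using \<delta>(1) by (simp add: field_simps)
        then show "z \<in> {z \<in> K. ht z \<le> max (t / \<delta>) (cmod P + t) \<and> cmod z \<le> max (t / \<delta>) (cmod P + t)}"
          using z(1) zb by (auto simp: le_max_iff_disj)
      qed
    qed (use inj in \<open>auto simp: inj_on_def\<close>)
    then have "ennreal (1 / sqrt 2) * lagrange_number K ht P
        \<le> ennreal (1 / sqrt 2) * (ennreal (sqrt 2) * lagrange_number Z Ht (g P))"
      by (intro mult_left_mono) auto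
    also have "\<dots> = lagrange_number Z Ht (g P)"
      by (simp add: mult.assoc[symmetric] ennreal_mult'[symmetric])
    finally show "ennreal (1 / sqrt 2) * lagrange_number K ht P \<le> lagrange_number Z Ht (g P)" .
    show "lagrange_number Z Ht (g P) \<le> ennreal (1 / sqrt 2) * lagrange_number K ht P"
    proof (rule lagrange_number_le_of_embedding[where F = "{N}" and \<phi> = "inv g"])
      fix k t :: real assume k: "k > 1" and t: "t > 0"
      have k2: "k\<^sup>2 > 1" using k by simp
      then have "h P * 1 < h P * k\<^sup>2" using hpos[of P] by (intro mult_strict_left_mono) auto
      then have hk: "h P / k\<^sup>2 < h P" using k2 by (subst pos_divide_less_eq) auto
      then have "h P - h P / k\<^sup>2 > 0" by simp
      from near[OF this] obtain \<delta> where \<delta>: "\<delta> > 0"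
        "\<And>z. cmod (P - z) < \<delta> \<Longrightarrow> \<bar>h z - h P\<bar> < h P - h P / k\<^sup>2" by blast
      \<comment> \<open>Away from \<open>P\<close> the conformal factor is still at least
        \<open>sqrt (m / h P)\<close>, so \<open>Ht (g z) * dist (g P) (g z)\<close> is at least
        \<open>ht z * b\<close>.\<close>
      define b where "b = sqrt 2 * \<delta> * sqrt (m / h P)"
      have b: "b > 0" using \<delta>(1) m hpos[of P] by (simp add: b_def)
      let ?S = "{z \<in> K. ht z \<le> max (t / b) (h P / m) \<and> cmod z \<le> max (t / b) (h P / m)}"
      show "finite {x \<in> Z. Ht x * dist (g P) x < t \<and>
             \<not> (inv g x \<in> K \<and> ht (inv g x) * dist P (inv g x) \<le> k * (1 / sqrt 2 * (Ht x * dist (g P) x)))}"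
      proof (rule finite_subset[where B = "insert N (g ` ?S)"], rule subsetI)
        show "finite (insert N (g ` ?S))" using fin[of "max (t / b) (h P / m)"] by blast
        fix x assume x: "x \<in> {x \<in> Z. Ht x * dist (g P) x < t \<and>
             \<not> (inv g x \<in> K \<and> ht (inv g x) * dist P (inv g x) \<le> k * (1 / sqrt 2 * (Ht x * dist (g P) x)))}"
        show "x \<in> insert N (g ` ?S)"
        proof (cases "x = N")
          case False
          then have "x \<in> g ` K" using Z x by blast
          then obtain z where z: "z \<in> K" "x = g z" by blast
          have lt: "ht z * h z * dist (g P) (g z) < t" using x z ht_g by auto
          have "\<not> (ht z * dist P z \<le> k * (1 / sqrt 2 * (ht z * h z * dist (g P) (g z))))"
            using x z inv_f_f[OF inj, of z] by (auto simp: ht_g)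
          then have *: "k * (ht z * cmod (P - z)) * sqrt (h z / h P) < ht z * cmod (P - z)"
            unfolding prod by (simp add: dist_norm mult_ac)
          have lt1: "k * sqrt (h z / h P) < 1"
          proof (rule ccontr)
            assume "\<not> k * sqrt (h z / h P) < 1"
            then have "(ht z * cmod (P - z)) * 1 \<le> (ht z * cmod (P - z)) * (k * sqrt (h z / h P))"
              using ht[OF z(1)] by (intro mult_left_mono) auto
            then show False using * by (simp add: mult_ac)
          qed
          have "sqrt (k\<^sup>2 * (h z / h P)) < 1"
            using lt1 k by (simp only: real_sqrt_mult real_sqrt_abs)
          then have "k\<^sup>2 * (h z / h P) < 1" by simp
          then have "h z * k\<^sup>2 < h P" using hpos[of P] by (simp add: field_simps)
          then have hz: "h z < h P / k\<^sup>2" using k2 by (subst pos_less_divide_eq) auto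
          then have far: "\<not> cmod (P - z) < \<delta>" using \<delta>(2)[of z] by auto
          \<comment> \<open>An exception has a small \<open>h z\<close>, and the quadratic growth of
            \<open>h\<close> confines it to a disc: the neighbourhood of \<open>N\<close>, the point
            at infinity, contributes no exceptions of large modulus.\<close>
          have "m * (1 + (cmod z)\<^sup>2) < h P" using hz hk h_low[of z] by linarith
          then have "1 + (cmod z)\<^sup>2 < h P / m" using m by (simp add: field_simps)
          moreover have "2 * cmod z \<le> 1 + (cmod z)\<^sup>2"
            using zero_le_power2[of "cmod z - 1"] by (simp add: power2_eq_square algebra_simps)
          ultimately have zb: "cmod z \<le> h P / m"
            using norm_ge_zero[of z] by linarith
          have "sqrt (m / h P) \<le> sqrt (h z / h P)"
            using hm[of z] hpos[of P] by (simp add: divide_right_mono)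
          then have "(sqrt 2 * ht z * \<delta>) * sqrt (m / h P) \<le> (sqrt 2 * ht z * cmod (P - z)) * sqrt (h z / h P)"
            using far ht[OF z(1)] \<delta>(1) m hpos[of P] by (intro mult_mono) auto
          also have "\<dots> < t" using lt unfolding prod .
          finally have "ht z * b < t" by (simp add: b_def mult_ac)
          then have "ht z \<le> t / b" using b by (simp add: field_simps)
          then show ?thesis using zb z by auto
        qed simp
      qed
    next
      show "inj_on (inv g) (Z - {N})"
        unfolding Z(1)[symmetric] using inj by (auto simp: inj_on_def)
    qed auto
  qed
  have XZ: "X - Z = g ` (UNIV - K)"
  proof -
    have "X - Z = (X - {N}) - (Z - {N})" using Z(2) by blast
    also have "\<dots> = g ` (UNIV - K)"
      unfolding X[symmetric] Z(1)[symmetric] using inj by (simp add: image_set_diff)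
    finally show ?thesis .
  qed
  have pos: "ennreal (1 / sqrt 2) * a > 0 \<longleftrightarrow> a > 0" for a
    by (simp add: ennreal_zero_less_mult_iff)
  have 1: "lagrange_spectrum X Z Ht =
      (\<lambda>P. lagrange_number Z Ht (g P)) ` {P. P \<notin> K \<and> lagrange_number Z Ht (g P) > 0}"
    unfolding lagrange_spectrum_def XZ by blast
  have 2: "lagrange_spectrum UNIV K ht = lagrange_number K ht ` {P. P \<notin> K \<and> lagrange_number K ht P > 0}"
    unfolding lagrange_spectrum_def by blast
  show ?thesis
    unfolding 1 2 scale_set_def image_image L pos ..
qed

section \<open>Heights and quadratic algebraic integers\<close>

text \<open>Two primitive representations satisfy \<open>q' * p = q * p'\<close>; comparing the gcds
  of both sides gives equal absolute denominators.\<close>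

lemma rational_height_eq:
  fixes p :: "int ^ 'n"
  assumes "Gcd (range (($) p)) = 1" "q \<noteq> 0" "x = (\<chi> i. of_int (p $ i) / of_int q)"
  shows "rational_height x = \<bar>of_int q\<bar>"
  unfolding rational_height_def
proof (rule the_equality)
  fix h :: real
  assume "\<exists>(p :: int ^ 'n) (q :: int). Gcd (range (($) p)) = 1 \<and> q \<noteq> 0 \<and>
     x = (\<chi> i. of_int (p $ i) / of_int q) \<and> h = \<bar>of_int q\<bar>"
  then obtain p' q' where *: "Gcd (range (($) p')) = 1" "q' \<noteq> 0"
     "x = (\<chi> i. of_int (p' $ i) / of_int q')" "h = \<bar>of_int q'\<bar>" by blast
  have "q' * p $ i = q * p' $ i" for i
  proof -
    have "real_of_int (p $ i) / of_int q = of_int (p' $ i) / of_int q'"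
      using assms(3) *(3) by (metis vec_lambda_beta)
    then have "real_of_int (q' * p $ i) = of_int (q * p' $ i)"
      using assms(2) *(2) by (simp add: field_simps)
    then show ?thesis by linarith
  qed
  then have "(*) q' ` range (($) p) = (*) q ` range (($) p')"
    by (simp add: image_image)
  then have "normalize (q' * Gcd (range (($) p))) = normalize (q * Gcd (range (($) p')))"
    by (metis Gcd_mult)
  then have "\<bar>q'\<bar> = \<bar>q\<bar>" using assms(1) *(1) by simp
  then show "h = \<bar>of_int q\<bar>" using *(4) by (simp flip: of_int_abs)
qed (use assms in blast)

text \<open>
  Pseudo-division by the primitive integral minimal polynomial and multiplicativity of the content
  show that this polynomial divides every monic integral polynomial vanishing at \<open>z\<close>.
\<close>

lemma quadratic_algebraic_int:
  fixes z :: complex and s n :: rat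
  assumes z: "algebraic_int z" "Im z \<noteq> 0" and eq: "z\<^sup>2 = of_rat s * z - of_rat n"
  shows "s \<in> \<int> \<and> n \<in> \<int>"
proof -
  let ?I = "map_poly of_int :: int poly \<Rightarrow> complex poly"
  have I_mult: "?I (f * g) = ?I f * ?I g" for f g
    by (simp add: poly_eq_iff coeff_map_poly coeff_mult)
  have I_add: "?I (f + g) = ?I f + ?I g" for f g
    by (simp add: poly_eq_iff coeff_map_poly)
  have I_smult: "?I (smult c f) = smult (of_int c) (?I f)" for c f
    by (simp add: poly_eq_iff coeff_map_poly)
  obtain p where p: "poly (?I p) z = 0" "lead_coeff p = 1"
    using z(1) unfolding algebraic_int_altdef_ipoly by blast
  obtain s1 s2 where s: "s = of_int s1 / of_int s2" "s2 > 0"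
    by (metis quotient_of_denom_pos' quotient_of_div surj_pair snd_conv)
  obtain n1 n2 where n: "n = of_int n1 / of_int n2" "n2 > 0"
    by (metis quotient_of_denom_pos' quotient_of_div surj_pair snd_conv)
  \<comment> \<open>\<open>f\<close> clears the denominators of \<open>X^2 - s X + n\<close>, and
    \<open>e\<close> is the primitive integral multiple of that polynomial.\<close>
  define f where "f = [:n1 * s2, - s1 * n2, s2 * n2:]"
  define e where "e = primitive_part f"
  have f0: "f \<noteq> 0" using s n by (simp add: f_def)
  have f: "f = smult (content f) e" by (simp add: e_def)
  have deg: "degree e = 2" using s n by (simp add: e_def f_def)
  have e0: "e \<noteq> 0" using f0 by (auto simp: e_def)
  have ce: "content e = 1" using f0 by (simp add: e_def)
  have "poly (?I f) z = of_int (s2 * n2) * (z\<^sup>2 - (of_rat s * z - of_rat n))"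
  proof -
    have "(of_rat s :: complex) = of_int s1 / of_int s2" "(of_rat n :: complex) = of_int n1 / of_int n2"
      using s n by (simp_all add: of_rat_divide)
    then show ?thesis
      using s(2) n(2) by (simp add: f_def map_poly_pCons field_simps power2_eq_square)
  qed
  then have "poly (?I (smult (content f) e)) z = 0" using eq f by simp
  then have ez: "poly (?I e) z = 0" using f0 by (simp add: I_smult)
  obtain a g where a: "a \<noteq> 0" "smult a p = e * g + pseudo_mod p e"
    using pseudo_mod(1)[OF e0, of p] by blast
  define r where "r = pseudo_mod p e"
  have "poly (?I (smult a p)) z = 0" using p by (simp add: I_smult)
  then have rz: "poly (?I r) z = 0" using ez by (simp add: a(2) r_def[symmetric] I_add I_mult)
  have "r = 0 \<or> degree r < 2" using pseudo_mod(2)[OF e0, of p] deg by (simp add: r_def)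
  then have "degree r \<le> 1" by auto
  then obtain r0 r1 where r: "r = [:r0, r1:]"
    by (metis degree_eq_zeroE le_antisym degree1_coeffs less_one linorder_not_le pCons_0_0 order_le_less pCons_eq_0_iff)
  \<comment> \<open>A remainder of degree at most one has real coefficients and the nonreal root
    \<open>z\<close>, so it vanishes.\<close>
  have "Im (of_int r0 + of_int r1 * z) = 0" "Re (of_int r0 + of_int r1 * z) = 0"
    using rz by (simp_all add: r map_poly_pCons mult.commute)
  then have "r = 0" using z(2) by (simp add: r)
  then have ap: "smult a p = e * g" using a(2) r_def by simp
  have "content p dvd 1" by (metis content_dvd_coeff p(2))
  then have cp: "content p = 1" by (metis is_unit_content_iff normalize_content is_unit_normalize)
  \<comment> \<open>Gauss's lemma: both \<open>p\<close> and \<open>e\<close> have content 1, so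
    \<open>a\<close> can be cancelled, and the leading coefficient of \<open>e\<close> divides that
    of the monic \<open>p\<close>.\<close>
  have "content g = \<bar>a\<bar>" using arg_cong[OF ap, of content] cp ce by (simp add: content_mult)
  then have "smult a p = smult \<bar>a\<bar> (e * primitive_part g)"
    by (metis ap content_times_primitive_part mult_smult_right)
  then have "\<bar>a\<bar> * lead_coeff (e * primitive_part g) = a * lead_coeff p"
    by (metis lead_coeff_smult)
  then have "\<bar>a\<bar> * \<bar>lead_coeff e * lead_coeff (primitive_part g)\<bar> = \<bar>a\<bar>"
    by (metis abs_abs abs_mult p(2) mult.right_neutral lead_coeff_mult)
  then have "\<bar>lead_coeff e * lead_coeff (primitive_part g)\<bar> = 1"
    using a(1) by simp
  then have "lead_coeff e dvd 1" by (metis dvd_triv_left dvd_abs_iff)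
  then have u: "\<bar>coeff e 2\<bar> = 1" using deg by simp
  define c where "c = content f"
  have c: "s2 * n2 = c * coeff e 2" "- s1 * n2 = c * coeff e 1" "n1 * s2 = c * coeff e 0"
    using arg_cong[OF f, of "\<lambda>f. coeff f 2"] arg_cong[OF f, of "\<lambda>f. coeff f 1"]
      arg_cong[OF f, of "\<lambda>f. coeff f 0"]
    by (simp_all add: f_def c_def numeral_2_eq_2)
  have "coeff e 2 * coeff e 2 = 1" using u by (auto simp: abs_if split: if_splits)
  \<comment> \<open>As \<open>e\<close> is monic up to sign, the leading coefficient
    \<open>s2 * n2\<close> of \<open>f\<close> divides the other two, which removes the denominators
    of \<open>s\<close> and \<open>n\<close>.\<close>
  then have "s1 * n2 = s2 * n2 * (- coeff e 2 * coeff e 1)" "n1 * s2 = s2 * n2 * (coeff e 2 * coeff e 0)"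
    using c by algebra+
  then have "s2 * n2 dvd s1 * n2" "s2 * n2 dvd n1 * s2" by (metis dvd_triv_left)+
  then have "s2 dvd s1" "n2 dvd n1" using s n by auto
  then show ?thesis using s n by (auto elim!: dvdE)
qed

text \<open>The square of the reduced denominator divides \<open>k\<close>, and \<open>k\<close> is
  at most 3, so the denominator is 1.\<close>

lemma Ints_of_square_multiple:
  fixes y :: rat and k :: int
  assumes "of_int k * y\<^sup>2 \<in> \<int>" "k \<in> {1, 2, 3}"
  shows "y \<in> \<int>"
proof -
  obtain a b where y: "y = of_int a / of_int b" "b > 0" "coprime a b"
    by (metis quotient_of_coprime quotient_of_denom_pos' quotient_of_div surj_pair snd_conv)
  obtain j where "of_int k * y\<^sup>2 = of_int j" using assms(1) by (auto elim: Ints_cases)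
  then have "(of_int (k * a\<^sup>2) :: rat) = of_int (j * b\<^sup>2)"
    using y(2) by (simp add: y(1) field_simps)
  then have eq: "k * a\<^sup>2 = j * b\<^sup>2" by linarith
  have cop: "coprime (b\<^sup>2) (a\<^sup>2)" using y(3) by (simp add: coprime_commute)
  have "b\<^sup>2 dvd k * a\<^sup>2" using eq by simp
  then have "b\<^sup>2 dvd k" using cop by (metis coprime_dvd_mult_left_iff)
  then have "b\<^sup>2 \<le> 3" using assms(2) zdvd_imp_le[of "b\<^sup>2" k] by auto
  have "b < 2"
  proof (rule ccontr)
    assume "\<not> b < 2"
    then have "2\<^sup>2 \<le> b\<^sup>2" by (intro power_mono) auto
    then show False using \<open>b\<^sup>2 \<le> 3\<close> by simp
  qed
  then have "b = 1" using y(2) by simp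
  then show ?thesis using y(1) by simp
qed

lemma of_real_of_rat: "of_real (of_rat q) = (of_rat q :: complex)"
  by (cases q) (simp add: of_rat_rat)

text \<open>The two numbers are the trace and the norm of \<open>z\<close>, the coefficients of its
  quadratic equation. For \<open>y = 0\<close> the number is real and rational, and the integrality
  of rational algebraic integers is used instead.\<close>

lemma algebraic_int_quadratic_field:
  assumes z: "z = of_rat x + of_rat y * csqrt (of_int D)" "algebraic_int z" and D: "D < 0"
  shows "2 * x \<in> \<int> \<and> x\<^sup>2 - of_int D * y\<^sup>2 \<in> \<int>"
proof (cases "y = 0")
  case True
  then have "(of_rat x :: complex) \<in> \<int>" using z by (intro rational_algebraic_int_is_int) auto
  then have "x \<in> \<int>" by (metis Ints_cases Ints_of_int of_rat_eq_iff of_rat_of_int_eq)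
  then show ?thesis using True by auto
next
  case False
  have sq: "(csqrt (of_int D))\<^sup>2 = of_int D" by simp
  have "z\<^sup>2 = of_rat (2 * x) * z - of_rat (x\<^sup>2 - of_int D * y\<^sup>2)"
    unfolding z(1) by (simp add: of_rat_mult of_rat_diff of_rat_power power_mult_distrib sq
        power2_sum field_simps power2_eq_square[of "complex_of_rat x"]
        del: power2_csqrt)
  moreover have "Im z \<noteq> 0"
  proof -
    have "csqrt (of_int D) = \<i> * of_real (sqrt (- of_int D))"
      using D csqrt_of_real_nonpos[of "of_int D"] by simp
    moreover note of_real_of_rat[symmetric]
    ultimately show ?thesis using False D z(1) by (simp add: algebra_simps)
  qed
  ultimately show ?thesis using quadratic_algebraic_int[OF z(2)] by blast
qed

section \<open>Euclidean imaginary quadratic fields\<close>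

text \<open>The parameters \<open>t\<close> and \<open>n\<close> are the trace and norm of
  \<open>\<omega>\<close>, a root of \<open>X^2 - t X + n\<close>, so that one integral basis
  \<open>1, \<omega>\<close> serves all three fields. The last assumption is division with remainder
  for the norm.\<close>

locale euclidean_quadratic =
  fixes K :: "complex set" and \<omega> :: complex and t n :: int
  assumes field: "K = {of_rat a + of_rat b * \<omega> | a b. True}"
    and integers: "ring_of_integers K = {of_int a + of_int b * \<omega> | a b. True}"
    and Im_omega: "Im \<omega> > 0"
    and trace_omega: "2 * Re \<omega> = of_int t"
    and norm_omega: "(cmod \<omega>)\<^sup>2 = of_int n"
    and euclidean: "\<And>z. \<exists>q\<in>ring_of_integers K. cmod (z - q) < 1"
begin

abbreviation "\<O> \<equiv> ring_of_integers K"

section \<open>Real coordinates of the plane with respect to the basis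
  \<open>1, \<omega>\<close>\<close>

definition v :: "complex \<Rightarrow> real" where "v z = Im z / Im \<omega>"
definition u :: "complex \<Rightarrow> real" where "u z = Re z - v z * Re \<omega>"

lemma coords_eq: "z = of_real (u z) + of_real (v z) * \<omega>"
  using Im_omega by (simp add: complex_eq_iff u_def v_def)

lemma coords_linear [simp]:
  "u (z + w) = u z + u w" "v (z + w) = v z + v w"
  "u (z - w) = u z - u w" "v (z - w) = v z - v w"
  "u (of_real r * z) = r * u z" "v (of_real r * z) = r * v z"
  "u (of_int i * z) = of_int i * u z" "v (of_int i * z) = of_int i * v z"
  "u (of_rat q * z) = of_rat q * u z" "v (of_rat q * z) = of_rat q * v z"
  by (simp_all add: u_def v_def algebra_simps add_divide_distrib diff_divide_distrib
      flip: of_real_of_rat)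

lemma coords_base [simp]:
  "u \<omega> = 0" "v \<omega> = 1" "u (of_int i) = of_int i" "v (of_int i) = 0"
  "u (of_rat q) = of_rat q" "v (of_rat q) = 0"
  "u (of_real r) = r" "v (of_real r) = 0"
  using Im_omega by (simp_all add: u_def v_def flip: of_real_of_rat)

lemma coords_divide [simp]: "u (z / of_real r) = u z / r" "v (z / of_real r) = v z / r"
  using coords_linear(5,6)[of "1 / r" z] by simp_all

lemma cmod_coords: "(cmod z)\<^sup>2 = (u z)\<^sup>2 + of_int t * u z * v z + of_int n * (v z)\<^sup>2"
proof -
  have "of_int n = (Re \<omega>)\<^sup>2 + (Im \<omega>)\<^sup>2" by (simp add: cmod_power2 flip: norm_omega)
  then have "(cmod (of_real a + of_real b * \<omega>))\<^sup>2 = a\<^sup>2 + of_int t * a * b + of_int n * b\<^sup>2" for a b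
    by (simp add: cmod_power2 flip: trace_omega) (simp add: power2_eq_square algebra_simps)
  from this[of "u z" "v z"] show ?thesis unfolding coords_eq[of z, symmetric] .
qed

lemma omega_squared: "\<omega> * \<omega> = of_int t * \<omega> - of_int n"
proof -
  have "of_int n = (of_real ((Re \<omega>)\<^sup>2 + (Im \<omega>)\<^sup>2) :: complex)"
    by (simp add: norm_omega flip: cmod_power2)
  moreover have "of_int t = (of_real (2 * Re \<omega>) :: complex)" by (simp add: trace_omega)
  ultimately show ?thesis by (simp add: complex_eq_iff power2_eq_square)
qed

lemma mult_coords:
  "u (z * w) = u z * u w - v z * v w * of_int n"
  "v (z * w) = u z * v w + v z * u w + v z * v w * of_int t"
proof -
  have "z * w = (of_real (u z) + of_real (v z) * \<omega>) * (of_real (u w) + of_real (v w) * \<omega>)"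
    using coords_eq[of z] coords_eq[of w] by (rule arg_cong2)
  also have "\<dots> = of_real (u z * u w) + of_real (u z * v w + v z * u w) * \<omega> + of_real (v z * v w) * (\<omega> * \<omega>)"
    by (simp add: algebra_simps)
  finally have eq: "z * w = of_real (u z * u w) + of_real (u z * v w + v z * u w) * \<omega> +
    of_real (v z * v w) * (of_int t * \<omega> - of_int n)" unfolding omega_squared .
  have "u (of_real a + of_real b * \<omega> + of_real c * (of_int t * \<omega> - of_int n)) = a - c * of_int n"
    "v (of_real a + of_real b * \<omega> + of_real c * (of_int t * \<omega> - of_int n)) = b + c * of_int t" for a b c
    by simp_all
  from this[of "u z * u w" "u z * v w + v z * u w" "v z * v w"]
  show "u (z * w) = u z * u w - v z * v w * of_int n"
    "v (z * w) = u z * v w + v z * u w + v z * v w * of_int t"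
    unfolding eq .
qed

lemma cnj_coords: "u (cnj z) = u z + v z * of_int t" "v (cnj z) = - v z"
  using Im_omega by (simp_all add: u_def v_def algebra_simps flip: trace_omega)

text \<open>This is the trace form in the basis \<open>1, \<omega>\<close>, with Gram matrix rows
  \<open>(2, t)\<close> and \<open>(t, t * t - 2 * n)\<close>. It explains the combinations of
  \<open>c\<close> and \<open>d\<close> in the divisibility conditions on the spheres.\<close>

lemma trace_mult:
  "2 * Re (z * w) = u w * (2 * u z + of_int t * v z) +
     v w * (of_int t * u z + (of_int t * of_int t - 2 * of_int n) * v z)"
proof -
  have "2 * Re x = 2 * u x + of_int t * v x" for x
    by (simp add: u_def flip: trace_omega)
  from this[of "z * w"] show ?thesis unfolding mult_coords by (simp add: algebra_simps)
qed

section \<open>The ring of integers as a lattice\<close>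

lemma integers_iff: "z \<in> \<O> \<longleftrightarrow> u z \<in> \<int> \<and> v z \<in> \<int>"
proof
  assume "u z \<in> \<int> \<and> v z \<in> \<int>"
  then obtain i j where "u z = of_int i" "v z = of_int j" by (auto elim!: Ints_cases)
  then show "z \<in> \<O>" using coords_eq[of z] unfolding integers by auto
qed (auto simp: integers)

lemma field_iff: "z \<in> K \<longleftrightarrow> u z \<in> \<rat> \<and> v z \<in> \<rat>"
proof
  assume "u z \<in> \<rat> \<and> v z \<in> \<rat>"
  then obtain i j where "u z = of_rat i" "v z = of_rat j" by (auto elim!: Rats_cases)
  then show "z \<in> K" using coords_eq[of z] unfolding field by (auto simp: of_real_of_rat)
qed (auto simp: field)

lemma integersE:
  assumes "z \<in> \<O>"
  obtains i j where "u z = of_int i" "v z = of_int j"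
  using assms by (auto simp: integers_iff elim!: Ints_cases)

lemma integers_closed [intro]:
  assumes "z \<in> \<O>" "w \<in> \<O>"
  shows "z + w \<in> \<O>" "z - w \<in> \<O>" "z * w \<in> \<O>" "cnj z \<in> \<O>"
proof -
  show "z + w \<in> \<O>" "z - w \<in> \<O>" using assms by (simp_all add: integers_iff)
  show "z * w \<in> \<O>" "cnj z \<in> \<O>" using assms by (simp_all add: integers_iff mult_coords cnj_coords)
qed

lemma zero_one_integer [simp]: "0 \<in> \<O>" "1 \<in> \<O>"
  using coords_base(3,4)[of 0] coords_base(3,4)[of 1] by (simp_all add: integers_iff)

lemma norm_integer:
  assumes "z \<in> \<O>" shows "(cmod z)\<^sup>2 \<in> \<int>"
  using assms by (simp add: cmod_coords integers_iff)

lemma norm_ge_1: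
  assumes "z \<in> \<O>" "z \<noteq> 0" shows "(cmod z)\<^sup>2 \<ge> 1"
proof -
  obtain i where i: "(cmod z)\<^sup>2 = of_int i" using norm_integer[OF assms(1)] by (elim Ints_cases)
  have "(cmod z)\<^sup>2 > 0" using assms(2) by simp
  then show ?thesis unfolding i by simp
qed

lemma finite_integers: "finite {z\<in>\<O>. cmod z \<le> B}"
proof -
  \<comment> \<open>The imaginary part bounds the coordinate \<open>v\<close>, and then the triangle
    inequality bounds \<open>u\<close>.\<close>
  define M where "M = max (B / Im \<omega>) (B + B / Im \<omega> * cmod \<omega>)"
  let ?I = "{r\<in>\<int>. \<bar>r\<bar> \<le> M}"
  have "z \<in> (\<lambda>(a, b). of_real a + of_real b * \<omega>) ` (?I \<times> ?I)" if z: "z \<in> \<O>" "cmod z \<le> B" for z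
  proof -
    have v: "\<bar>v z\<bar> \<le> B / Im \<omega>"
      using z(2) abs_Im_le_cmod[of z] Im_omega by (simp add: v_def divide_right_mono)
    have "\<bar>u z\<bar> = cmod (z - of_real (v z) * \<omega>)"
    proof -
      have "z - of_real (v z) * \<omega> = of_real (u z)" using coords_eq[of z] by (metis add_diff_cancel_right')
      then show ?thesis by simp
    qed
    also have "\<dots> \<le> cmod z + \<bar>v z\<bar> * cmod \<omega>" by (metis norm_triangle_ineq4 norm_mult norm_of_real)
    also have "\<dots> \<le> B + B / Im \<omega> * cmod \<omega>" using z(2) v by (intro add_mono mult_right_mono) auto
    finally have "u z \<in> ?I" "v z \<in> ?I" using z(1) v by (auto simp: integers_iff M_def)
    then show ?thesis by (intro image_eqI[of _ _ "(u z, v z)"]) (simp_all flip: coords_eq)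
  qed
  then have "{z\<in>\<O>. cmod z \<le> B} \<subseteq> (\<lambda>(a, b). of_real a + of_real b * \<omega>) ` (?I \<times> ?I)" by blast
  then show ?thesis
    by (rule finite_subset) (intro finite_imageI finite_cartesian_product finite_abs_int_segment)
qed

section \<open>Coprime fractions and the height on the field\<close>

lemma generate_unit_ideal_iff:
  assumes "\<alpha> \<in> \<O>" "\<beta> \<in> \<O>"
  shows "generate_unit_ideal \<O> \<alpha> \<beta> \<longleftrightarrow> (\<exists>\<gamma>\<in>\<O>. \<exists>\<delta>\<in>\<O>. \<alpha> * \<gamma> + \<beta> * \<delta> = 1)"
proof
  assume "generate_unit_ideal \<O> \<alpha> \<beta>"
  then have "1 \<in> {\<alpha> * \<gamma> + \<beta> * \<delta> | \<gamma> \<delta>. \<gamma> \<in> \<O> \<and> \<delta> \<in> \<O>}"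
    by (simp add: generate_unit_ideal_def)
  then show "\<exists>\<gamma>\<in>\<O>. \<exists>\<delta>\<in>\<O>. \<alpha> * \<gamma> + \<beta> * \<delta> = 1" by force
next
  assume "\<exists>\<gamma>\<in>\<O>. \<exists>\<delta>\<in>\<O>. \<alpha> * \<gamma> + \<beta> * \<delta> = 1"
  then obtain \<gamma> \<delta> where *: "\<gamma> \<in> \<O>" "\<delta> \<in> \<O>" "\<alpha> * \<gamma> + \<beta> * \<delta> = 1" by blast
  have "x = \<alpha> * (\<gamma> * x) + \<beta> * (\<delta> * x)" for x
    using arg_cong[OF *(3), of "\<lambda>y. y * x"] by (simp add: algebra_simps)
  then show "generate_unit_ideal \<O> \<alpha> \<beta>"
    unfolding generate_unit_ideal_def using * assms
    by (auto intro!: integers_closed(1,3))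
qed

text \<open>Class number one by Euclid: in the ideal generated by a numerator and a denominator, a
  nonzero element \<open>d\<close> of least norm divides both, and the quotients by \<open>d\<close>
  are coprime.\<close>

lemma coprime_representation:
  assumes "z \<in> K"
  obtains \<alpha> \<beta> where "\<alpha> \<in> \<O>" "\<beta> \<in> \<O>" "\<beta> \<noteq> 0" "generate_unit_ideal \<O> \<alpha> \<beta>" "z = \<alpha> / \<beta>"
proof -
  obtain p q where pq: "u z = of_int p / of_int q" "q \<noteq> (0::int)"
    using assms unfolding field_iff by (auto elim!: Rats_cases')
  obtain r s where rs: "v z = of_int r / of_int s" "s \<noteq> (0::int)"
    using assms unfolding field_iff by (auto elim!: Rats_cases')
  define a where "a = of_int (p * s) + of_int (r * q) * \<omega>"
  define b where "b = (of_int (q * s) :: complex)"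
  have ab: "a \<in> \<O>" "b \<in> \<O>" "b \<noteq> 0" "z = a / b"
  proof -
    show "a \<in> \<O>" unfolding integers a_def by blast
    have "b = of_int (q * s) + of_int 0 * \<omega>" by (simp add: b_def)
    then show "b \<in> \<O>" unfolding integers by blast
    show "b \<noteq> 0" using pq rs by (simp add: b_def)
    show "z = a / b"
    proof -
      have "z = of_real (of_int p / of_int q) + of_real (of_int r / of_int s) * \<omega>"
        using coords_eq[of z] unfolding pq rs .
      also have "\<dots> = a / b" using pq rs by (simp add: a_def b_def field_simps)
      finally show ?thesis .
    qed
  qed
  define I where "I = {a * \<gamma> + b * \<delta> | \<gamma> \<delta>. \<gamma> \<in> \<O> \<and> \<delta> \<in> \<O>}"
  have I_sub: "I \<subseteq> \<O>" using ab by (auto simp: I_def intro!: integers_closed)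
  have I_comb: "x - q * y \<in> I" if xyq: "x \<in> I" "y \<in> I" "q \<in> \<O>" for x y q
  proof -
    obtain \<gamma> \<delta> \<gamma>' \<delta>' where *: "x = a * \<gamma> + b * \<delta>" "y = a * \<gamma>' + b * \<delta>'"
      "\<gamma> \<in> \<O>" "\<delta> \<in> \<O>" "\<gamma>' \<in> \<O>" "\<delta>' \<in> \<O>" using xyq unfolding I_def by blast
    then have "x - q * y = a * (\<gamma> - q * \<gamma>') + b * (\<delta> - q * \<delta>')" by (simp add: algebra_simps)
    then show ?thesis unfolding I_def using * xyq(3) by (blast intro: integers_closed)
  qed
  have aI: "a \<in> I" unfolding I_def by (rule CollectI, rule exI[of _ 1], rule exI[of _ 0]) simp
  have bI: "b \<in> I" unfolding I_def by (rule CollectI, rule exI[of _ 0], rule exI[of _ 1]) simp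
  \<comment> \<open>Norms of integers are integers, so the floor only changes the type and the least
    number principle for \<open>nat\<close> applies.\<close>
  have "\<exists>d. (d \<in> I \<and> d \<noteq> 0) \<and> (\<forall>y. y \<in> I \<and> y \<noteq> 0 \<longrightarrow> nat \<lfloor>(cmod d)\<^sup>2\<rfloor> \<le> nat \<lfloor>(cmod y)\<^sup>2\<rfloor>)"
    using bI ab(3) by (intro ex_has_least_nat) blast
  then obtain d where d: "d \<in> I" "d \<noteq> 0"
    and min: "\<And>y. y \<in> I \<Longrightarrow> y \<noteq> 0 \<Longrightarrow> nat \<lfloor>(cmod d)\<^sup>2\<rfloor> \<le> nat \<lfloor>(cmod y)\<^sup>2\<rfloor>" by blast
  have dvd: "\<exists>q\<in>\<O>. x = d * q" if "x \<in> I" for x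
  proof -
    obtain q where q: "q \<in> \<O>" "cmod (x / d - q) < 1" using euclidean by blast
    have "x - q * d = 0"
    proof (rule ccontr)
      assume nz: "x - q * d \<noteq> 0"
      have in_I: "x - q * d \<in> I" using that d(1) q(1) by (rule I_comb)
      have "cmod (x - q * d) = cmod (x / d - q) * cmod d"
        using d(2) by (simp add: norm_mult[symmetric] algebra_simps)
      also have "\<dots> < cmod d" using q(2) d(2) by simp
      finally have lt: "(cmod (x - q * d))\<^sup>2 < (cmod d)\<^sup>2" by (intro power_strict_mono) auto
      obtain i j where "(cmod (x - q * d))\<^sup>2 = of_int i" "(cmod d)\<^sup>2 = of_int j"
        using norm_integer in_I d(1) I_sub by (meson Ints_cases subsetD)
      then show False using lt min[OF in_I nz] zero_le_power2[of "cmod (x - q * d)"] by simp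
    qed
    then show ?thesis using q(1) by (auto simp: mult.commute)
  qed
  obtain \<alpha> \<beta> where \<alpha>\<beta>: "\<alpha> \<in> \<O>" "a = d * \<alpha>" "\<beta> \<in> \<O>" "b = d * \<beta>" using dvd[OF aI] dvd[OF bI] by blast
  obtain \<gamma> \<delta> where "\<gamma> \<in> \<O>" "\<delta> \<in> \<O>" "d = a * \<gamma> + b * \<delta>" using d(1) unfolding I_def by blast
  moreover from this have "d * (\<alpha> * \<gamma> + \<beta> * \<delta>) = d * 1" using \<alpha>\<beta> by (simp add: algebra_simps)
  ultimately have "generate_unit_ideal \<O> \<alpha> \<beta>"
    using d(2) \<alpha>\<beta> by (auto simp: generate_unit_ideal_iff)
  then show thesis using that[of \<alpha> \<beta>] \<alpha>\<beta> ab d(2) by auto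
qed

text \<open>The Bezout relation shows that \<open>\<beta>\<close> divides \<open>\<beta>'\<close>,
  and the cofactor has norm at least 1. By symmetry all coprime denominators of one number have the
  same modulus, so \<open>field_height\<close> is well defined.\<close>

lemma coprime_denominator_le:
  assumes "\<alpha> \<in> \<O>" "\<beta> \<in> \<O>" "\<beta> \<noteq> 0" "generate_unit_ideal \<O> \<alpha> \<beta>"
    and "\<alpha>' \<in> \<O>" "\<beta>' \<in> \<O>" "\<beta>' \<noteq> 0" "\<alpha> / \<beta> = \<alpha>' / \<beta>'"
  shows "(cmod \<beta>)\<^sup>2 \<le> (cmod \<beta>')\<^sup>2"
proof -
  obtain \<gamma> \<delta> where *: "\<gamma> \<in> \<O>" "\<delta> \<in> \<O>" "\<alpha> * \<gamma> + \<beta> * \<delta> = 1"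
    using assms(4) generate_unit_ideal_iff[OF assms(1,2)] by blast
  have "\<beta>' = (\<alpha> * \<beta>') * \<gamma> + \<beta> * \<beta>' * \<delta>"
    using arg_cong[OF *(3), of "\<lambda>y. y * \<beta>'"] by (simp add: algebra_simps)
  also have "\<alpha> * \<beta>' = \<beta> * \<alpha>'" using assms by (simp add: field_simps)
  finally have eq: "\<beta>' = \<beta> * (\<alpha>' * \<gamma> + \<beta>' * \<delta>)" by (simp add: algebra_simps)
  let ?e = "\<alpha>' * \<gamma> + \<beta>' * \<delta>"
  have "?e \<noteq> 0" using eq assms(7) by (metis mult_zero_right)
  moreover have "?e \<in> \<O>" using assms * by (intro integers_closed) auto
  ultimately have "1 \<le> (cmod ?e)\<^sup>2" by (intro norm_ge_1)
  then have "(cmod \<beta>)\<^sup>2 * 1 \<le> (cmod \<beta>)\<^sup>2 * (cmod ?e)\<^sup>2" by (intro mult_left_mono) auto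
  also have "\<dots> = (cmod (\<beta> * ?e))\<^sup>2" by (simp add: norm_mult power_mult_distrib)
  also have "\<dots> = (cmod \<beta>')\<^sup>2" unfolding eq[symmetric] ..
  finally show ?thesis by simp
qed

lemma field_height_eq:
  assumes "\<alpha> \<in> \<O>" "\<beta> \<in> \<O>" "\<beta> \<noteq> 0" "generate_unit_ideal \<O> \<alpha> \<beta>"
  shows "field_height K (\<alpha> / \<beta>) = (cmod \<beta>)\<^sup>2"
  unfolding field_height_def
proof (rule the_equality)
  show "\<exists>\<alpha>'\<in>\<O>. \<exists>\<beta>'\<in>\<O>. \<beta>' \<noteq> 0 \<and> generate_unit_ideal \<O> \<alpha>' \<beta>' \<and>
      \<alpha> / \<beta> = \<alpha>' / \<beta>' \<and> (cmod \<beta>)\<^sup>2 = (cmod \<beta>')\<^sup>2" using assms by blast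
  fix h assume "\<exists>\<alpha>'\<in>\<O>. \<exists>\<beta>'\<in>\<O>. \<beta>' \<noteq> 0 \<and> generate_unit_ideal \<O> \<alpha>' \<beta>' \<and>
      \<alpha> / \<beta> = \<alpha>' / \<beta>' \<and> h = (cmod \<beta>')\<^sup>2"
  then obtain \<alpha>' \<beta>' where *: "\<alpha>' \<in> \<O>" "\<beta>' \<in> \<O>" "\<beta>' \<noteq> 0" "generate_unit_ideal \<O> \<alpha>' \<beta>'"
      "\<alpha> / \<beta> = \<alpha>' / \<beta>'" "h = (cmod \<beta>')\<^sup>2" by blast
  have "(cmod \<beta>)\<^sup>2 \<le> (cmod \<beta>')\<^sup>2" "(cmod \<beta>')\<^sup>2 \<le> (cmod \<beta>)\<^sup>2"
    using coprime_denominator_le assms * by metis+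
  then show "h = (cmod \<beta>)\<^sup>2" using *(6) by simp
qed

lemma field_height_ge_1:
  assumes "z \<in> K" shows "1 \<le> field_height K z"
proof -
  obtain \<alpha> \<beta> where "\<alpha> \<in> \<O>" "\<beta> \<in> \<O>" "\<beta> \<noteq> 0" "generate_unit_ideal \<O> \<alpha> \<beta>" "z = \<alpha> / \<beta>"
    using coprime_representation[OF assms] .
  then show ?thesis using field_height_eq norm_ge_1 by simp
qed

text \<open>A bounded height leaves finitely many denominators, and a bounded modulus then leaves
  finitely many numerators \<open>\<alpha> = z * \<beta>\<close>.\<close>

lemma finite_bounded_height: "finite {z\<in>K. field_height K z \<le> B \<and> cmod z \<le> B}"
proof -
  let ?S = "{z\<in>\<O>. cmod z \<le> B * B} \<times> {z\<in>\<O>. cmod z \<le> B}"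
  have "z \<in> (\<lambda>(\<alpha>, \<beta>). \<alpha> / \<beta>) ` ?S" if z: "z \<in> K" "field_height K z \<le> B" "cmod z \<le> B" for z
  proof -
    obtain \<alpha> \<beta> where *: "\<alpha> \<in> \<O>" "\<beta> \<in> \<O>" "\<beta> \<noteq> 0" "generate_unit_ideal \<O> \<alpha> \<beta>" "z = \<alpha> / \<beta>"
      using coprime_representation[OF z(1)] .
    have sq: "(cmod \<beta>)\<^sup>2 \<le> B" using z(2) * by (simp add: field_height_eq)
    have "1 \<le> (cmod \<beta>)\<^sup>2" using norm_ge_1 * by blast
    then have "1 \<le> cmod \<beta>" using power2_le_imp_le[of 1 "cmod \<beta>"] by simp
    then have "cmod \<beta> * 1 \<le> cmod \<beta> * cmod \<beta>" by (intro mult_left_mono) auto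
    then have \<beta>: "cmod \<beta> \<le> B" using sq by (simp add: power2_eq_square)
    have "cmod \<alpha> = cmod z * cmod \<beta>" using * by (simp add: norm_divide)
    also have "\<dots> \<le> B * B" using z(3) \<beta> order_trans[OF norm_ge_zero z(3)] by (intro mult_mono) auto
    finally show ?thesis using * \<beta> by force
  qed
  then have "{z\<in>K. field_height K z \<le> B \<and> cmod z \<le> B} \<subseteq> (\<lambda>(\<alpha>, \<beta>). \<alpha> / \<beta>) ` ?S" by blast
  then show ?thesis
    by (rule finite_subset) (intro finite_imageI finite_cartesian_product finite_integers)
qed

end

section \<open>Spheres as null cones of Hermitian matrices\<close>

context euclidean_quadratic
begin

text \<open>The Hermitian matrix of \<open>z\<close> has diagonal
  \<open>(\<bar>z\<bar>\<^sup>2, 1)\<close> and off-diagonal entry \<open>z\<close>.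
  \<open>conf\<close> is a linear form on it, the denominator of the point of the sphere and the
  \<open>h\<close> of the conformal factor; \<open>coord\<close> gives a numerator.\<close>

definition conf :: "int \<Rightarrow> int \<Rightarrow> complex \<Rightarrow> real" where
  "conf r s z = (cmod z)\<^sup>2 + 1 + of_int r * u z + of_int s * v z"

definition coord :: "int \<Rightarrow> int \<Rightarrow> int \<Rightarrow> int \<Rightarrow> complex \<Rightarrow> real" where
  "coord a b c d z = of_int a * (cmod z)\<^sup>2 + of_int b + of_int c * u z + of_int d * v z"

lemma continuous_conf: "continuous_on UNIV (conf r s)"
  unfolding conf_def u_def v_def using Im_omega by (intro continuous_intros) auto

text \<open>
  \<open>(A, B, C, D)\<close> maps the Hermitian matrix with diagonal \<open>(a, b)\<close> and off-diagonal entry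
  \<open>c + d * \<omega>\<close> to the numerators of a point of the sphere whose denominator is \<open>a + b + r * c + s * d\<close>;
  \<open>isometry\<close> says that it carries the polarised determinant to the form of the light cone.
\<close>

lemma lagrange_spectrum_sphere:
  fixes A B C D :: "'n::finite \<Rightarrow> int" and r s \<kappa> :: int and X :: "(real ^ 'n) set"
  defines "g \<equiv> \<lambda>z. \<chi> i. coord (A i) (B i) (C i) (D i) z / conf r s z"
  assumes m: "m > 0" "\<And>z. m * (1 + (cmod z)\<^sup>2) \<le> conf r s z"
    and isometry: "\<And>z w. of_int \<kappa> * conf r s z * conf r s w
        - (\<Sum>i\<in>UNIV. coord (A i) (B i) (C i) (D i) z * coord (A i) (B i) (C i) (D i) w) = (cmod (z - w))\<^sup>2"
    and N: "N \<in> X" "N \<in> rational_points"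
    and g_in: "\<And>z. g z \<in> X - {N}"
    and g_inv: "\<And>x. x \<in> X - {N} \<Longrightarrow> \<exists>z. g z = x \<and> (x \<in> rational_points \<longrightarrow> z \<in> K)"
    and primitive: "\<And>l a b c d. prime l \<Longrightarrow> (\<And>i. l dvd A i * a + B i * b + C i * c + D i * d) \<Longrightarrow>
        (\<Sum>i\<in>UNIV. (A i * a + B i * b + C i * c + D i * d)\<^sup>2) = \<kappa> * (a + b + r * c + s * d)\<^sup>2 \<Longrightarrow>
        l dvd a \<and> l dvd b \<and> l dvd 2 * c + t * d \<and> l dvd t * c + (t * t - 2 * n) * d"
  shows "lagrange_spectrum X (X \<inter> rational_points) rational_height =
     scale_set (1 / sqrt 2) (lagrange_spectrum UNIV K (field_height K))"
proof (rule lagrange_spectrum_conformal[where g = g and h = "conf r s" and N = N and m = m])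
  define num where "num i = coord (A i) (B i) (C i) (D i)" for i
  have hpos: "conf r s z > 0" for z
    using m(2)[of z] m(1) by (smt (verit, best) mult_pos_pos zero_le_power2)
  \<comment> \<open>This is \<open>isometry\<close> divided by both denominators. At
    \<open>z = w\<close> it gives squared radius \<open>\<kappa>\<close>, and polarisation then
    gives the distance formula.\<close>
  have inner: "g z \<bullet> g w = of_int \<kappa> - (cmod (z - w))\<^sup>2 / (conf r s z * conf r s w)" for z w
  proof -
    have "g z \<bullet> g w = (\<Sum>i\<in>UNIV. num i z * num i w) / (conf r s z * conf r s w)"
      by (simp add: inner_vec_def g_def num_def sum_divide_distrib)
    also have "(\<Sum>i\<in>UNIV. num i z * num i w) = of_int \<kappa> * conf r s z * conf r s w - (cmod (z - w))\<^sup>2"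
      using isometry[of z w] by (simp add: num_def)
    finally show ?thesis using hpos[of z] hpos[of w] by (simp add: diff_divide_distrib)
  qed
  show dist_g: "(dist (g z) (g w))\<^sup>2 = 2 * (cmod (z - w))\<^sup>2 / (conf r s z * conf r s w)" for z w
  proof -
    have "(dist (g z) (g w))\<^sup>2 = g z \<bullet> g z + g w \<bullet> g w - 2 * (g z \<bullet> g w)"
      by (simp add: dist_norm power2_norm_eq_inner inner_diff inner_commute)
    then show ?thesis by (simp add: inner)
  qed
  have inj: "z = w" if "g z = g w" for z w
    using dist_g[of z w] that hpos[of z] hpos[of w] by simp
  show range: "range g = X - {N}" using g_in g_inv by blast
  have rat: "g z \<in> rational_points" if "z \<in> K" for z
    using that by (auto simp: rational_points_def g_def coord_def conf_def field_iff cmod_coords)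
  show "g ` K = X \<inter> rational_points - {N}"
    using g_in g_inv rat inj by blast
  show "N \<in> X \<inter> rational_points" using N by simp
  show "rational_height (g z) = field_height K z * conf r s z" if zK: "z \<in> K" for z
  proof -
    obtain \<alpha> \<beta> where \<alpha>\<beta>: "\<alpha> \<in> \<O>" "\<beta> \<in> \<O>" "\<beta> \<noteq> 0" "generate_unit_ideal \<O> \<alpha> \<beta>" "z = \<alpha> / \<beta>"
      using coprime_representation[OF zK] .
    obtain \<gamma> \<delta> where \<gamma>\<delta>: "\<gamma> \<in> \<O>" "\<delta> \<in> \<O>" "\<alpha> * \<gamma> + \<beta> * \<delta> = 1"
      using \<alpha>\<beta>(4) generate_unit_ideal_iff[OF \<alpha>\<beta>(1,2)] by blast
    \<comment> \<open>Scaling the matrix of \<open>z\<close> by the norm of \<open>\<beta>\<close>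
      makes it integral, with entries \<open>a\<close>, \<open>b\<close>,
      \<open>c + d * \<omega>\<close>. The numbers \<open>e\<close>, \<open>f\<close>,
      \<open>i\<close>, \<open>j\<close> are the entries of the matrix of the Bezout pair.\<close>
    obtain a where a: "(cmod \<alpha>)\<^sup>2 = of_int a" using norm_integer[OF \<alpha>\<beta>(1)] by (elim Ints_cases)
    obtain b where b: "(cmod \<beta>)\<^sup>2 = of_int b" using norm_integer[OF \<alpha>\<beta>(2)] by (elim Ints_cases)
    obtain c d where cd: "u (\<alpha> * cnj \<beta>) = of_int c" "v (\<alpha> * cnj \<beta>) = of_int d"
      using integersE[OF integers_closed(3)[OF \<alpha>\<beta>(1) integers_closed(4)[OF \<alpha>\<beta>(2,2)]]] .
    obtain e where e: "(cmod \<gamma>)\<^sup>2 = of_int e" using norm_integer[OF \<gamma>\<delta>(1)] by (elim Ints_cases)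
    obtain f where f: "(cmod \<delta>)\<^sup>2 = of_int f" using norm_integer[OF \<gamma>\<delta>(2)] by (elim Ints_cases)
    obtain i j where ij: "u (\<gamma> * cnj \<delta>) = of_int i" "v (\<gamma> * cnj \<delta>) = of_int j"
      using integersE[OF integers_closed(3)[OF \<gamma>\<delta>(1) integers_closed(4)[OF \<gamma>\<delta>(2,2)]]] .
    have b0: "b > 0" using \<alpha>\<beta>(3) b by (metis of_int_0_less_iff zero_less_norm_iff zero_less_power)
    have "(of_real (of_int b) :: complex) = \<beta> * cnj \<beta>"
      unfolding b[symmetric] by (rule complex_norm_square)
    then have z_eq: "z = (\<alpha> * cnj \<beta>) / of_real (of_int b)"
      using \<alpha>\<beta>(3,5) by simp
    have z: "(cmod z)\<^sup>2 = of_int a / of_int b" "u z = of_int c / of_int b" "v z = of_int d / of_int b"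
    proof -
      show "(cmod z)\<^sup>2 = of_int a / of_int b" using \<alpha>\<beta>(5) a b by (simp add: norm_divide power_divide)
      show "u z = of_int c / of_int b" "v z = of_int d / of_int b"
        unfolding z_eq coords_divide cd by simp_all
    qed
    define p :: "int ^ 'n" where "p = (\<chi> i. A i * a + B i * b + C i * c + D i * d)"
    define q where "q = a + b + r * c + s * d"
    have conf: "conf r s z = of_int q / of_int b"
      using b0 by (simp add: conf_def z q_def field_simps)
    have num: "num i z = of_int (p $ i) / of_int b" for i
      using b0 by (simp add: num_def coord_def z p_def field_simps)
    have q0: "q > 0" using hpos[of z] b0 by (simp add: conf zero_less_divide_iff)
    have gz: "g z = (\<chi> i. of_int (p $ i) / of_int q)"
      unfolding g_def num_def[symmetric] num conf using b0 by simp
    have sq: "(\<Sum>i\<in>UNIV. (p $ i)\<^sup>2) = \<kappa> * q\<^sup>2"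
    proof -
      have "(\<Sum>i\<in>UNIV. num i z * num i z) = of_int \<kappa> * conf r s z * conf r s z"
        using isometry[of z z] by (simp add: num_def)
      then have "real_of_int (\<Sum>i\<in>UNIV. (p $ i)\<^sup>2) / (of_int b)\<^sup>2 = of_int (\<kappa> * q\<^sup>2) / (of_int b)\<^sup>2"
        by (simp add: num conf power2_eq_square sum_divide_distrib)
      then have "real_of_int (\<Sum>i\<in>UNIV. (p $ i)\<^sup>2) = of_int (\<kappa> * q\<^sup>2)"
        using b0 by (simp del: of_int_sum of_int_mult of_int_power)
      then show ?thesis by linarith
    qed
    text \<open>
      Expanding \<open>1 = (cmod (\<alpha> * \<gamma> + \<beta> * \<delta>))\<^sup>2\<close> bounds the common divisors of the entries of \<open>p\<close>.
    \<close>
    have bezout: "a * e + b * f + (i * (2 * c + t * d) + j * (t * c + (t * t - 2 * n) * d)) = 1"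
    proof -
      have "(1::real) = (cmod (\<alpha> * \<gamma> + \<beta> * \<delta>))\<^sup>2" using \<gamma>\<delta>(3) by simp
      also have "\<dots> = (cmod \<alpha>)\<^sup>2 * (cmod \<gamma>)\<^sup>2 + (cmod \<beta>)\<^sup>2 * (cmod \<delta>)\<^sup>2
          + 2 * Re ((\<alpha> * cnj \<beta>) * (\<gamma> * cnj \<delta>))"
        by (simp add: cmod_power2) (simp add: power2_eq_square algebra_simps)
      also have "\<dots> = of_int (a * e + b * f + (i * (2 * c + t * d) + j * (t * c + (t * t - 2 * n) * d)))"
        unfolding trace_mult a b e f cd ij by simp
      finally show ?thesis by linarith
    qed
    have "Gcd (range (($) p)) = 1"
    proof (rule ccontr)
      assume "Gcd (range (($) p)) \<noteq> 1"
      then have "\<not> is_unit (Gcd (range (($) p)))" by (metis is_unit_normalize normalize_Gcd)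
      \<comment> \<open>A vanishing gcd is a nonunit too, and there the prime 2 serves as
        \<open>l\<close>.\<close>
      then obtain l where l: "prime l" "l dvd Gcd (range (($) p))"
        by (metis dvd_0_right prime_divisorE two_is_prime)
      have "l dvd p $ i" for i using l(2) by (meson Gcd_dvd dvd_trans rangeI)
      then have "l dvd a \<and> l dvd b \<and> l dvd 2 * c + t * d \<and> l dvd t * c + (t * t - 2 * n) * d"
        using sq by (intro primitive[OF l(1)]) (simp_all add: p_def q_def)
      then have "l dvd 1" unfolding bezout[symmetric] by (blast intro: dvd_add dvd_mult dvd_mult2)
      then show False using l(1) by (meson not_prime_unit)
    qed
    from rational_height_eq[OF this _ gz] have "rational_height (g z) = of_int q"
      using q0 by simp
    also have "\<dots> = field_height K z * conf r s z"
    proof -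
      have "field_height K z = of_int b"
        using field_height_eq[OF \<alpha>\<beta>(1-4)] by (simp only: \<alpha>\<beta>(5) b)
      then show ?thesis using b0 by (simp add: conf)
    qed
    finally show ?thesis .
  qed
qed (use m field_height_ge_1 finite_bounded_height continuous_conf in auto)

end

section \<open>The fields of discriminant -4, -8 and -3\<close>

lemma csqrt_of_neg_int: "D < 0 \<Longrightarrow> csqrt (of_int D) = \<i> * of_real (sqrt (- of_int D))"
  using csqrt_of_real_nonpos[of "of_int D"] by simp

lemma algebraic_int_quadraticI:
  assumes "z\<^sup>2 = of_int s * z - of_int n"
  shows "algebraic_int (z :: complex)"
proof (rule algebraic_int.intros)
  show "poly [:of_int n, - of_int s, 1:] z = 0"
    using assms by (simp add: power2_eq_square algebra_simps)
  show "\<forall>i. coeff [:of_int n, - of_int s, 1:] i \<in> (\<int> :: complex set)"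
    by (simp add: coeff_pCons split: nat.split)
qed simp

text \<open>Modulo 4 the expression depends only on the parities of \<open>m\<close> and
  \<open>j\<close>, so four cases remain. This separates the rings spanned by \<open>1\<close> and
  the square root from the one with half-integers.\<close>

lemma four_dvd_square_plus:
  fixes m j k :: int
  assumes "4 dvd m\<^sup>2 + k * j\<^sup>2"
  shows "k \<in> {1, 2} \<Longrightarrow> even m \<and> even j" "k = 3 \<Longrightarrow> even (m - j)"
proof -
  have m: "m = 2 * (m div 2) + m mod 2" and j: "j = 2 * (j div 2) + j mod 2" by simp_all
  define a b e f where "a = m div 2" "b = j div 2" "e = m mod 2" "f = j mod 2"
  have ef: "e \<in> {0, 1}" "f \<in> {0, 1}" by (auto simp: a_b_e_f_def)
  have "m\<^sup>2 + k * j\<^sup>2 = 4 * (a\<^sup>2 + a * e + k * (b\<^sup>2 + b * f)) + (e\<^sup>2 + k * f\<^sup>2)"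
    by (subst m, subst j) (simp add: a_b_e_f_def[symmetric] power2_eq_square algebra_simps)
  then have *: "4 dvd e\<^sup>2 + k * f\<^sup>2" using assms by (metis dvd_add_right_iff dvd_triv_left)
  show "even m \<and> even j" if "k \<in> {1, 2}"
    using * ef that unfolding a_b_e_f_def by (auto simp: even_iff_mod_2_eq_zero)
  show "even (m - j)" if "k = 3"
  proof -
    have "e = f" using * ef that by auto
    then show ?thesis unfolding a_b_e_f_def by presburger
  qed
qed

text \<open>The integral trace gives \<open>m = 2 * x\<close>. Then
  \<open>(- D) * (2 * y)\<^sup>2\<close> is four times the norm minus \<open>m\<^sup>2\<close>, so
  \<open>2 * y\<close> is integral as well; integrality of the norm is the divisibility by
  4.\<close>

lemma ring_of_integers_quadraticE:
  assumes D: "D \<in> {-1, -2, -3}" and z: "z \<in> ring_of_integers (quadratic_field D)"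
  obtains m j :: int where "z = (of_int m + of_int j * csqrt (of_int D)) / 2" "4 dvd m\<^sup>2 + (- D) * j\<^sup>2"
proof -
  obtain x y where xy: "z = of_rat x + of_rat y * csqrt (of_int D)" and alg: "algebraic_int z"
    using z unfolding ring_of_integers_def quadratic_field_def by blast
  have int: "2 * x \<in> \<int>" "x\<^sup>2 - of_int D * y\<^sup>2 \<in> \<int>"
    using algebraic_int_quadratic_field[OF xy alg] D by auto
  obtain m where m: "2 * x = of_int m" using int(1) by (elim Ints_cases)
  obtain N where N: "x\<^sup>2 - of_int D * y\<^sup>2 = of_int N" using int(2) by (elim Ints_cases)
  have "of_int (- D) * (2 * y)\<^sup>2 = 4 * (x\<^sup>2 - of_int D * y\<^sup>2) - (2 * x)\<^sup>2"
    by (simp add: power2_eq_square algebra_simps)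
  also have "\<dots> \<in> \<int>" unfolding m N by auto
  finally have "2 * y \<in> \<int>" by (rule Ints_of_square_multiple[of "- D"]) (use D in auto)
  then obtain j where j: "2 * y = of_int j" by (elim Ints_cases)
  have "(of_int (m\<^sup>2 + (- D) * j\<^sup>2) :: rat) = of_int (4 * N)"
    by (simp add: m[symmetric] j[symmetric] N[symmetric] power2_eq_square algebra_simps)
  then have eq: "m\<^sup>2 + (- D) * j\<^sup>2 = 4 * N" by linarith
  have half: "x = of_int m / 2" "y = of_int j / 2" using m j by (simp_all add: field_simps)
  have "z = (of_int m + of_int j * csqrt (of_int D)) / 2"
    unfolding xy half by (simp add: of_rat_divide add_divide_distrib)
  then show thesis using that eq by (metis dvd_triv_left)
qed

lemma euclidean_quadratic_sqrt:
  assumes D: "D \<in> {-1, -2}"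
  shows "euclidean_quadratic (quadratic_field D) (csqrt (of_int D)) 0 (- D)"
proof
  define w where "w = csqrt (of_int D)"
  have w: "w = \<i> * of_real (sqrt (- of_int D))" using D by (auto simp: w_def csqrt_of_neg_int)
  have k: "real_of_int (- D) > 0" "real_of_int (- D) \<le> 2" using D by auto
  show "quadratic_field D = {of_rat a + of_rat b * csqrt (of_int D) | a b. True}"
    by (simp add: quadratic_field_def)
  show ring: "ring_of_integers (quadratic_field D) = {of_int a + of_int b * csqrt (of_int D) | a b. True}"
  proof (intro equalityI subsetI)
    fix z assume "z \<in> ring_of_integers (quadratic_field D)"
    then obtain m j where z: "z = (of_int m + of_int j * csqrt (of_int D)) / 2"
      and dvd: "4 dvd m\<^sup>2 + (- D) * j\<^sup>2"
      using D by (elim ring_of_integers_quadraticE[rotated]) auto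
    have "even m" "even j" using four_dvd_square_plus(1)[OF dvd] D by auto
    then obtain a b where "m = 2 * a" "j = 2 * b" by (elim evenE)
    then have "z = of_int a + of_int b * csqrt (of_int D)" unfolding z by (simp add: add_divide_distrib)
    then show "z \<in> {of_int a + of_int b * csqrt (of_int D) | a b. True}" by blast
  next
    fix z assume "z \<in> {of_int a + of_int b * csqrt (of_int D) | a b. True}"
    then obtain a b where z: "z = of_int a + of_int b * csqrt (of_int D)" by blast
    then have "z = of_rat (of_int a) + of_rat (of_int b) * csqrt (of_int D)" by simp
    then have "z \<in> quadratic_field D" unfolding quadratic_field_def by blast
    moreover have "(x + y * w)\<^sup>2 = 2 * x * (x + y * w) - (x\<^sup>2 - w\<^sup>2 * y\<^sup>2)" for x y w :: complex
      by algebra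
    from this[of "of_int a" "of_int b" "csqrt (of_int D)"]
    have "z\<^sup>2 = of_int (2 * a) * z - of_int (a\<^sup>2 - D * b\<^sup>2)" by (simp add: z)
    then have "algebraic_int z" by (rule algebraic_int_quadraticI)
    ultimately show "z \<in> ring_of_integers (quadratic_field D)" by (simp add: ring_of_integers_def)
  qed
  show "Im (csqrt (of_int D)) > 0" "2 * Re (csqrt (of_int D)) = of_int 0"
    "(cmod (csqrt (of_int D)))\<^sup>2 = of_int (- D)"
    using k unfolding w_def[symmetric] w by (simp_all add: norm_mult)
  fix z :: complex
  define c where "c = sqrt (- of_int D)"
  have c: "c > 0" "c\<^sup>2 \<le> 2" using k by (simp_all add: c_def)
  \<comment> \<open>Rounding both coordinates in the rectangular lattice leaves a squared distance
    of at most \<open>1 / 4 + c\<^sup>2 / 4\<close>, that is at most \<open>3 / 4\<close>.\<close>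
  define q where "q = of_int (round (Re z)) + of_int (round (Im z / c)) * w"
  have "(Re (z - q))\<^sup>2 \<le> (1 / 2)\<^sup>2"
    using of_int_round_abs_le[of "Re z"]
    by (subst abs_le_square_iff[symmetric]) (simp add: q_def w c_def[symmetric] abs_minus_commute)
  moreover have "(Im (z - q))\<^sup>2 \<le> (c / 2)\<^sup>2"
  proof -
    have "Im (z - q) = c * (Im z / c - of_int (round (Im z / c)))"
      using c by (simp add: q_def w c_def[symmetric] algebra_simps)
    then have "\<bar>Im (z - q)\<bar> = c * \<bar>of_int (round (Im z / c)) - Im z / c\<bar>"
      using c by (simp add: abs_mult abs_minus_commute)
    also have "\<dots> \<le> c * (1 / 2)" using c of_int_round_abs_le by (intro mult_left_mono) auto
    finally show ?thesis using c by (subst abs_le_square_iff[symmetric]) simp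
  qed
  ultimately have "(cmod (z - q))\<^sup>2 < 1\<^sup>2"
    using c(2) unfolding cmod_power2 by (simp add: power_divide)
  then have "cmod (z - q) < 1" by (rule power2_less_imp_less) simp
  moreover have "q \<in> ring_of_integers (quadratic_field D)"
    unfolding ring q_def w_def by blast
  ultimately show "\<exists>q\<in>ring_of_integers (quadratic_field D). cmod (z - q) < 1" by blast
qed

lemma euclidean_quadratic_eisenstein:
  "euclidean_quadratic (quadratic_field (-3)) ((1 + csqrt (of_int (-3))) / 2) 1 1"
proof
  define \<theta> where "\<theta> = csqrt (of_int (-3))"
  define w where "w = (1 + \<theta>) / 2"
  have \<theta>: "\<theta> = \<i> * of_real (sqrt 3)" unfolding \<theta>_def by (subst csqrt_of_neg_int) simp_all
  have \<theta>2: "\<theta> * \<theta> = - 3" by (simp add: \<theta> mult.assoc[symmetric] flip: of_real_mult)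
    (simp add: complex_eq_iff)
  have \<theta>w: "\<theta> = 2 * w - 1" by (simp add: w_def add_divide_distrib)
  show K: "quadratic_field (-3) = {of_rat a + of_rat b * ((1 + csqrt (of_int (-3))) / 2) | a b. True}"
    unfolding quadratic_field_def \<theta>_def[symmetric]
  proof (intro equalityI subsetI)
    fix z assume "z \<in> {of_rat a + of_rat b * \<theta> | a b. True}"
    then obtain a b where "z = of_rat a + of_rat b * \<theta>" by blast
    then have "z = of_rat (a - b) + of_rat (2 * b) * ((1 + \<theta>) / 2)"
      by (simp add: of_rat_diff of_rat_mult algebra_simps)
    then show "z \<in> {of_rat a + of_rat b * ((1 + \<theta>) / 2) | a b. True}" by blast
  next
    fix z assume "z \<in> {of_rat a + of_rat b * ((1 + \<theta>) / 2) | a b. True}"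
    then obtain a b where "z = of_rat a + of_rat b * ((1 + \<theta>) / 2)" by blast
    then have "z = of_rat (a + b / 2) + of_rat (b / 2) * \<theta>"
      by (simp add: of_rat_add of_rat_divide add_divide_distrib algebra_simps)
    then show "z \<in> {of_rat a + of_rat b * \<theta> | a b. True}" by blast
  qed
  show ring: "ring_of_integers (quadratic_field (-3)) =
      {of_int a + of_int b * ((1 + csqrt (of_int (-3))) / 2) | a b. True}"
  proof (intro equalityI subsetI)
    fix z assume "z \<in> ring_of_integers (quadratic_field (-3))"
    then obtain m j where z: "z = (of_int m + of_int j * \<theta>) / 2"
      and dvd: "4 dvd m\<^sup>2 + (- (-3)) * j\<^sup>2"
      unfolding \<theta>_def by (elim ring_of_integers_quadraticE[rotated]) auto
    have "even (m - j)" using four_dvd_square_plus(2)[OF dvd] by simp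
    then obtain a where "m - j = 2 * a" by (elim evenE)
    then have "m = 2 * a + j" by simp
    then have "z = of_int a + of_int j * ((1 + csqrt (of_int (-3))) / 2)"
      unfolding z \<theta>_def[symmetric] by (simp add: field_simps)
    then show "z \<in> {of_int a + of_int b * ((1 + csqrt (of_int (-3))) / 2) | a b. True}" by blast
  next
    fix z assume "z \<in> {of_int a + of_int b * ((1 + csqrt (of_int (-3))) / 2) | a b. True}"
    then obtain a b where z: "z = of_int a + of_int b * ((1 + csqrt (of_int (-3))) / 2)" by blast
    then have "z = of_rat (of_int a) + of_rat (of_int b) * ((1 + csqrt (of_int (-3))) / 2)" by simp
    then have "z \<in> quadratic_field (-3)" unfolding K by blast
    moreover have zw: "z = of_int a + of_int b * w" using z unfolding w_def \<theta>_def .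
    have w2: "w * w = w - 1" using \<theta>2 unfolding \<theta>w by algebra
    have "(x + y * w)\<^sup>2 = (2 * x + y) * (x + y * w) - (x\<^sup>2 + x * y + y\<^sup>2)" for x y
      using w2 by algebra
    from this[of "of_int a" "of_int b"]
    have "z\<^sup>2 = of_int (2 * a + b) * z - of_int (a\<^sup>2 + a * b + b\<^sup>2)" by (simp add: zw)
    then have "algebraic_int z" by (rule algebraic_int_quadraticI)
    ultimately show "z \<in> ring_of_integers (quadratic_field (-3))" by (simp add: ring_of_integers_def)
  qed
  show "Im ((1 + csqrt (of_int (-3))) / 2) > 0" "2 * Re ((1 + csqrt (of_int (-3))) / 2) = of_int 1"
    "(cmod ((1 + csqrt (of_int (-3))) / 2))\<^sup>2 = of_int 1"
    unfolding \<theta>_def[symmetric] \<theta> by (simp_all add: cmod_power2 power_divide)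
  fix z :: complex
  define c where "c = sqrt 3 / 2"
  have c: "c > 0" "c\<^sup>2 = 3 / 4" by (simp_all add: c_def power_divide)
  have w: "Re w = 1 / 2" "Im w = c" by (simp_all add: w_def \<theta> c_def)
  \<comment> \<open>The imaginary coordinate is rounded first; the real part is then rounded after
    removing the shift \<open>j / 2\<close> caused by \<open>Re w = 1 / 2\<close>. The squared
    distance is at most \<open>1 / 4 + 3 / 16\<close>.\<close>
  define j where "j = round (Im z / c)"
  define m where "m = round (Re z - of_int j / 2)"
  define q where "q = of_int m + of_int j * w"
  have "(Re (z - q))\<^sup>2 \<le> (1 / 2)\<^sup>2"
    using of_int_round_abs_le[of "Re z - of_int j / 2"]
    by (subst abs_le_square_iff[symmetric]) (simp add: q_def w m_def[symmetric] abs_minus_commute algebra_simps)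
  moreover have "(Im (z - q))\<^sup>2 \<le> (c / 2)\<^sup>2"
  proof -
    have "Im (z - q) = c * (Im z / c - of_int (round (Im z / c)))"
      using c by (simp add: q_def w j_def algebra_simps)
    then have "\<bar>Im (z - q)\<bar> = c * \<bar>of_int (round (Im z / c)) - Im z / c\<bar>"
      using c by (simp add: abs_mult abs_minus_commute)
    also have "\<dots> \<le> c * (1 / 2)" using c of_int_round_abs_le by (intro mult_left_mono) auto
    finally show ?thesis using c by (subst abs_le_square_iff[symmetric]) simp
  qed
  ultimately have "(cmod (z - q))\<^sup>2 < 1\<^sup>2"
    using c(2) unfolding cmod_power2 by (simp add: power_divide)
  then have "cmod (z - q) < 1" by (rule power2_less_imp_less) simp
  moreover have "q \<in> ring_of_integers (quadratic_field (-3))"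
    unfolding ring q_def w_def \<theta>_def by blast
  ultimately show "\<exists>q\<in>ring_of_integers (quadratic_field (-3)). cmod (z - q) < 1" by blast
qed

section \<open>The three spheres\<close>

lemma vector_4 [simp]:
  "(vector [w, x, y, z] :: ('a::zero) ^ 4) $ 1 = w"
  "(vector [w, x, y, z] :: ('a::zero) ^ 4) $ 2 = x"
  "(vector [w, x, y, z] :: ('a::zero) ^ 4) $ 3 = y"
  "(vector [w, x, y, z] :: ('a::zero) ^ 4) $ 4 = z"
  unfolding vector_def by simp_all

context euclidean_quadratic
begin

lemma lagrange_spectrum_sphere_I:
  assumes tn: "t = 0" "n = 1"
  shows "lagrange_spectrum sphere_I (sphere_I \<inter> rational_points) rational_height =
     scale_set (1 / sqrt 2) (lagrange_spectrum UNIV K (field_height K))"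
proof -
  have norm: "(cmod z)\<^sup>2 = (u z)\<^sup>2 + (v z)\<^sup>2" for z using cmod_coords[of z] by (simp add: tn)
  \<comment> \<open>The vector \<open>A\<close> is the limit of the map at infinity, hence equal to
    \<open>N\<close>, and \<open>B\<close> is the image of 0. The same pattern holds on the other
    two spheres.\<close>
  define A :: "3 \<Rightarrow> int" where "A = ($) (vector [1, 0, 0] :: int ^ 3)"
  define B :: "3 \<Rightarrow> int" where "B = ($) (vector [0, 1, 0] :: int ^ 3)"
  define C :: "3 \<Rightarrow> int" where "C = ($) (vector [1, 1, 1] :: int ^ 3)"
  define D :: "3 \<Rightarrow> int" where "D = ($) (vector [1, 1, -1] :: int ^ 3)"
  define N :: "real ^ 3" where "N = vector [1, 0, 0]"
  note defs = A_def B_def C_def D_def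
  have conf: "conf 1 1 z = (u z)\<^sup>2 + (v z)\<^sup>2 + 1 + u z + v z" for z
    by (simp add: conf_def norm)
  have low: "1 / 4 * (1 + (cmod z)\<^sup>2) \<le> conf 1 1 z" for z
  proof -
    have "conf 1 1 z - 1 / 4 * (1 + (cmod z)\<^sup>2) = 3 / 4 * (u z + 2 / 3)\<^sup>2 + 3 / 4 * (v z + 2 / 3)\<^sup>2 + 1 / 12"
      unfolding conf norm by (simp add: power2_eq_square algebra_simps)
    then show ?thesis using zero_le_power2[of "u z + 2 / 3"] zero_le_power2[of "v z + 2 / 3"] by linarith
  qed
  have pos: "conf 1 1 z > 0" for z by (rule less_le_trans[OF _ low]) (simp add: add_pos_nonneg)
  have isom: "of_int 1 * conf 1 1 z * conf 1 1 w
        - (\<Sum>i\<in>UNIV. coord (A i) (B i) (C i) (D i) z * coord (A i) (B i) (C i) (D i) w) = (cmod (z - w))\<^sup>2" for z w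
    unfolding sum_3 coord_def conf norm by (simp add: defs power2_eq_square algebra_simps)
  show ?thesis
  proof (rule lagrange_spectrum_sphere[where A = A and B = B and C = C and D = D and N = N and m = "1 / 4"
        and r = 1 and s = 1 and \<kappa> = 1, OF _ low isom])
    show "N \<in> sphere_I" "N \<in> rational_points"
      by (simp_all add: N_def sphere_I_def rational_points_def forall_3)
    show "(\<chi> i. coord (A i) (B i) (C i) (D i) z / conf 1 1 z) \<in> sphere_I - {N}" for z
    proof -
      have "coord (A 1) (B 1) (C 1) (D 1) z / conf 1 1 z \<noteq> 1"
        using pos[of z] by (simp add: coord_def defs conf norm)
      moreover have "(coord (A 1) (B 1) (C 1) (D 1) z)\<^sup>2 + (coord (A 2) (B 2) (C 2) (D 2) z)\<^sup>2
          + (coord (A 3) (B 3) (C 3) (D 3) z)\<^sup>2 = (conf 1 1 z)\<^sup>2"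
        using isom[of z z] by (simp add: sum_3 power2_eq_square)
      ultimately show ?thesis using pos[of z]
        by (simp add: sphere_I_def N_def vec_eq_iff forall_3 power_divide add_divide_distrib[symmetric])
    qed
    fix x assume x: "x \<in> sphere_I - {N}"
    have sph: "(x $ 1)\<^sup>2 + (x $ 2)\<^sup>2 + (x $ 3)\<^sup>2 = 1" using x by (simp add: sphere_I_def)
    \<comment> \<open>The first numerator is \<open>conf - 1\<close>, so \<open>e\<close> must be
      the reciprocal of \<open>conf\<close> at the preimage. Then
      \<open>x $ 1 + x $ 2 - 1 = e * (a + b)\<close> and \<open>x $ 3 = e * (a - b)\<close>
      determine the preimage.\<close>
    define e where "e = 1 - x $ 1"
    have e: "e \<noteq> 0"
    proof
      assume "e = 0"
      then have "x $ 1 = 1" by (simp add: e_def)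
      moreover from this have "x $ 2 = 0" "x $ 3 = 0" using sph by (simp_all add: sum_power2_eq_zero_iff)
      ultimately have "x = N" by (simp add: vec_eq_iff forall_3 N_def)
      then show False using x by simp
    qed
    define a where "a = (x $ 1 + x $ 2 - 1 + x $ 3) / (2 * e)"
    define b where "b = (x $ 1 + x $ 2 - 1 - x $ 3) / (2 * e)"
    define z where "z = of_real a + of_real b * \<omega>"
    have uv: "u z = a" "v z = b" unfolding z_def by simp_all
    have ae: "2 * e * a = x $ 1 + x $ 2 - 1 + x $ 3" and be: "2 * e * b = x $ 1 + x $ 2 - 1 - x $ 3"
      using e by (simp_all add: a_def b_def)
    have "e * (e * (a\<^sup>2 + b\<^sup>2)) = e * (1 - x $ 2)"
      using ae be sph e_def by algebra
    then have ab: "e * (a\<^sup>2 + b\<^sup>2) = 1 - x $ 2" using e by simp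
    have h: "e * conf 1 1 z = 1"
      unfolding conf uv using ab ae be e_def by algebra
    have "x $ 1 = (a\<^sup>2 + b\<^sup>2 + a + b) * e" "x $ 2 = (1 + a + b) * e" "x $ 3 = (a - b) * e"
      using ab ae be e_def by algebra+
    note x_eq = this
    have "x $ i = coord (A i) (B i) (C i) (D i) z / conf 1 1 z" for i
    proof -
      have "x $ i = coord (A i) (B i) (C i) (D i) z * e" for i
        using exhaust_3[of i] by (auto simp: coord_def defs uv norm x_eq)
      then show ?thesis using h pos[of z] by (simp add: field_simps)
    qed
    moreover have "z \<in> K" if "x \<in> rational_points"
      using that unfolding field_iff uv a_def b_def e_def by (auto simp: rational_points_def)
    ultimately show "\<exists>z. (\<chi> i. coord (A i) (B i) (C i) (D i) z / conf 1 1 z) = x \<and>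
        (x \<in> rational_points \<longrightarrow> z \<in> K)"
      by (intro exI[of _ z]) (simp add: vec_eq_iff)
  next
    fix l a b c d :: int
    assume l: "prime l" and dvd: "\<And>i. l dvd A i * a + B i * b + C i * c + D i * d"
      and eq: "(\<Sum>i\<in>UNIV. (A i * a + B i * b + C i * c + D i * d)\<^sup>2) = 1 * (a + b + 1 * c + 1 * d)\<^sup>2"
    have p: "l dvd a + c + d" "l dvd b + c + d" "l dvd c - d"
      using dvd[of 1] dvd[of 2] dvd[of 3] by (simp_all add: defs)
    have "l dvd (\<Sum>i\<in>UNIV. (A i * a + B i * b + C i * c + D i * d)\<^sup>2)"
      by (intro dvd_sum) (simp add: power2_eq_square dvd)
    then have "l dvd (a + b + c + d)\<^sup>2" unfolding eq by simp
    then have q: "l dvd a + b + c + d" using l by (metis prime_dvd_power)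
    \<comment> \<open>From \<open>c + d\<close> and \<open>c - d\<close> only the doubles of
      \<open>c\<close> and \<open>d\<close> are reached, which is exactly what the trace form asks
      for when \<open>t = 0\<close>.\<close>
    have "l dvd a" "l dvd b" "l dvd 2 * c" "l dvd 2 * d"
    proof -
      show "l dvd a" "l dvd b" using dvd_diff[OF q p(2)] dvd_diff[OF q p(1)] by simp_all
      have cd: "l dvd c + d" using dvd_diff[OF dvd_add[OF p(1,2)] q] by simp
      show "l dvd 2 * c" "l dvd 2 * d" using dvd_add[OF cd p(3)] dvd_diff[OF cd p(3)] by simp_all
    qed
    then show "l dvd a \<and> l dvd b \<and> l dvd 2 * c + t * d \<and> l dvd t * c + (t * t - 2 * n) * d"
      by (simp add: tn)
  qed simp
qed

lemma lagrange_spectrum_sphere_II: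
  assumes tn: "t = 0" "n = 2"
  shows "lagrange_spectrum sphere_II (sphere_II \<inter> rational_points) rational_height =
     scale_set (1 / sqrt 2) (lagrange_spectrum UNIV K (field_height K))"
proof -
  have norm: "(cmod z)\<^sup>2 = (u z)\<^sup>2 + 2 * (v z)\<^sup>2" for z using cmod_coords[of z] by (simp add: tn)
  define A :: "3 \<Rightarrow> int" where "A = ($) (vector [1, 1, 0] :: int ^ 3)"
  define B :: "3 \<Rightarrow> int" where "B = ($) (vector [1, 0, 1] :: int ^ 3)"
  define C :: "3 \<Rightarrow> int" where "C = ($) (vector [2, 0, 0] :: int ^ 3)"
  define D :: "3 \<Rightarrow> int" where "D = ($) (vector [2, 2, 2] :: int ^ 3)"
  define N :: "real ^ 3" where "N = vector [1, 1, 0]"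
  note defs = A_def B_def C_def D_def
  have conf: "conf 1 2 z = (u z)\<^sup>2 + 2 * (v z)\<^sup>2 + 1 + u z + 2 * v z" for z
    by (simp add: conf_def norm)
  have low: "1 / 10 * (1 + (cmod z)\<^sup>2) \<le> conf 1 2 z" for z
  \<comment> \<open>The factor \<open>1 / 4\<close> of the first sphere would leave a negative
    constant after completing the squares; \<open>1 / 10\<close> leaves
    \<open>1 / 15\<close>.\<close>
  proof -
    have "conf 1 2 z - 1 / 10 * (1 + (cmod z)\<^sup>2) =
        9 / 10 * (u z + 5 / 9)\<^sup>2 + 9 / 5 * (v z + 5 / 9)\<^sup>2 + 1 / 15"
      unfolding conf norm by (simp add: power2_eq_square algebra_simps)
    then show ?thesis
      using zero_le_power2[of "u z + 5 / 9"] zero_le_power2[of "v z + 5 / 9"] by linarith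
  qed
  have pos: "conf 1 2 z > 0" for z by (rule less_le_trans[OF _ low]) (simp add: add_pos_nonneg)
  have isom: "of_int 2 * conf 1 2 z * conf 1 2 w
        - (\<Sum>i\<in>UNIV. coord (A i) (B i) (C i) (D i) z * coord (A i) (B i) (C i) (D i) w) = (cmod (z - w))\<^sup>2" for z w
    unfolding sum_3 coord_def conf norm by (simp add: defs power2_eq_square algebra_simps)
  show ?thesis
  proof (rule lagrange_spectrum_sphere[where A = A and B = B and C = C and D = D and N = N and m = "1 / 10"
        and r = 1 and s = 2 and \<kappa> = 2, OF _ low isom])
    show "N \<in> sphere_II" "N \<in> rational_points"
      by (simp_all add: N_def sphere_II_def rational_points_def forall_3)
    show "(\<chi> i. coord (A i) (B i) (C i) (D i) z / conf 1 2 z) \<in> sphere_II - {N}" for z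
    proof -
      have "coord (A 1) (B 1) (C 1) (D 1) z / conf 1 2 z + coord (A 2) (B 2) (C 2) (D 2) z / conf 1 2 z \<noteq> 2"
      proof -
        have "coord (A 1) (B 1) (C 1) (D 1) z + coord (A 2) (B 2) (C 2) (D 2) z = 2 * conf 1 2 z - 1"
          by (simp add: coord_def defs conf norm)
        then show ?thesis using pos[of z] by (simp add: add_divide_distrib[symmetric] divide_eq_eq)
      qed
      moreover have "(coord (A 1) (B 1) (C 1) (D 1) z)\<^sup>2 + (coord (A 2) (B 2) (C 2) (D 2) z)\<^sup>2
          + (coord (A 3) (B 3) (C 3) (D 3) z)\<^sup>2 = 2 * (conf 1 2 z)\<^sup>2"
        using isom[of z z] by (simp add: sum_3 power2_eq_square)
      ultimately show ?thesis using pos[of z]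
        by (auto simp: sphere_II_def N_def vec_eq_iff forall_3 power_divide add_divide_distrib[symmetric])
    qed
    fix x assume x: "x \<in> sphere_II - {N}"
    have sph: "(x $ 1)\<^sup>2 + (x $ 2)\<^sup>2 + (x $ 3)\<^sup>2 = 2" using x by (simp add: sphere_II_def)
    \<comment> \<open>The first two numerators add up to \<open>2 * conf - 1\<close>, so
      \<open>e\<close> is again the reciprocal of \<open>conf\<close>. It vanishes on the tangent
      plane at \<open>N\<close>, which meets the sphere only there.\<close>
    define e where "e = 2 - x $ 1 - x $ 2"
    have e: "e \<noteq> 0"
    proof
      assume "e = 0"
      then have "(x $ 1 - 1)\<^sup>2 + (x $ 2 - 1)\<^sup>2 + (x $ 3)\<^sup>2 = 0"
        using sph e_def by algebra
      then have "x $ 1 = 1" "x $ 2 = 1" "x $ 3 = 0"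
        by (simp_all add: add_nonneg_eq_0_iff)
      then have "x = N" by (simp add: vec_eq_iff forall_3 N_def)
      then show False using x by simp
    qed
    define a where "a = (x $ 1 - 1) / e"
    define b where "b = (x $ 1 + x $ 2 + x $ 3 - 2) / (2 * e)"
    define z where "z = of_real a + of_real b * \<omega>"
    have uv: "u z = a" "v z = b" unfolding z_def by simp_all
    have ae: "e * a = x $ 1 - 1" and be: "2 * e * b = x $ 1 + x $ 2 + x $ 3 - 2"
      using e by (simp_all add: a_def b_def)
    have "e * (e * (a\<^sup>2 + 2 * b\<^sup>2)) = e * (2 - x $ 1 - x $ 3)"
      using ae be sph e_def by algebra
    then have ab: "e * (a\<^sup>2 + 2 * b\<^sup>2) = 2 - x $ 1 - x $ 3" using e by simp
    have h: "e * conf 1 2 z = 1"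
      unfolding conf uv using ab ae be e_def by algebra
    have x_eq: "x $ 1 = (a\<^sup>2 + 2 * b\<^sup>2 + 1 + 2 * a + 2 * b) * e" "x $ 2 = (a\<^sup>2 + 2 * b\<^sup>2 + 2 * b) * e"
      "x $ 3 = (1 + 2 * b) * e"
      using ab ae be e_def by algebra+
    have "x $ i = coord (A i) (B i) (C i) (D i) z / conf 1 2 z" for i
    proof -
      have "x $ i = coord (A i) (B i) (C i) (D i) z * e" for i
        using exhaust_3[of i] by (auto simp: coord_def defs uv norm x_eq)
      then show ?thesis using h pos[of z] by (simp add: field_simps)
    qed
    moreover have "z \<in> K" if "x \<in> rational_points"
      using that unfolding field_iff uv a_def b_def e_def by (auto simp: rational_points_def)
    ultimately show "\<exists>z. (\<chi> i. coord (A i) (B i) (C i) (D i) z / conf 1 2 z) = x \<and>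
        (x \<in> rational_points \<longrightarrow> z \<in> K)"
      by (intro exI[of _ z]) (simp add: vec_eq_iff)
  next
    fix l a b c d :: int
    assume l: "prime l" and dvd: "\<And>i. l dvd A i * a + B i * b + C i * c + D i * d"
      and eq: "(\<Sum>i\<in>UNIV. (A i * a + B i * b + C i * c + D i * d)\<^sup>2) = 2 * (a + b + 1 * c + 2 * d)\<^sup>2"
    define q where "q = a + b + c + 2 * d"
    have p: "l dvd a + b + 2 * c + 2 * d" "l dvd a + 2 * d" "l dvd b + 2 * d"
      using dvd[of 1] dvd[of 2] dvd[of 3] by (simp_all add: defs)
    \<comment> \<open>The square of \<open>l\<close> is kept because for \<open>l = 2\<close> one
      factor is absorbed by \<open>\<kappa> = 2\<close>.\<close>
    have "l\<^sup>2 dvd (\<Sum>i\<in>UNIV. (A i * a + B i * b + C i * c + D i * d)\<^sup>2)"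
      using dvd by (intro dvd_sum dvd_power_same)
    then have l2: "l\<^sup>2 dvd 2 * q\<^sup>2" unfolding eq by (simp add: q_def)
    have "l dvd q\<^sup>2"
    proof (cases "l = 2")
      case True
      then have "2 * 2 dvd 2 * q\<^sup>2" using l2 by simp
      then show ?thesis unfolding True by (metis dvd_mult_cancel_left zero_neq_numeral)
    next
      case False
      then have "\<not> l dvd 2" using l two_is_prime primes_dvd_imp_eq by blast
      moreover have "l dvd 2 * q\<^sup>2" using l2 by (metis dvd_mult_left power2_eq_square)
      ultimately show ?thesis using l by (simp add: prime_dvd_mult_iff)
    qed
    then have q: "l dvd a + b + c + 2 * d" using l unfolding q_def by (metis prime_dvd_power)
    have c: "l dvd c" using dvd_diff[OF p(1) q] by simp
    have b: "l dvd b" using dvd_diff[OF dvd_diff[OF q c] p(2)] by simp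
    have a: "l dvd a" using dvd_diff[OF dvd_diff[OF q c] p(3)] by simp
    have "l dvd 2 * d" using dvd_diff[OF p(2) a] by simp
    then have "l dvd 2 * (2 * d)" by (rule dvd_mult)
    then show "l dvd a \<and> l dvd b \<and> l dvd 2 * c + t * d \<and> l dvd t * c + (t * t - 2 * n) * d"
      using a b c by (simp add: tn)
  qed simp
qed

lemma lagrange_spectrum_sphere_III:
  assumes tn: "t = 1" "n = 1"
  shows "lagrange_spectrum sphere_III (sphere_III \<inter> rational_points) rational_height =
     scale_set (1 / sqrt 2) (lagrange_spectrum UNIV K (field_height K))"
proof -
  \<comment> \<open>Indices of type \<open>4\<close> are taken modulo 4, so the coordinate
    \<open>x $ 0\<close> of the sphere is the last entry of a \<open>vector\<close>.\<close>
  have zero_4: "(0 :: 4) = 4" by simp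
  have norm: "(cmod z)\<^sup>2 = (u z)\<^sup>2 + u z * v z + (v z)\<^sup>2" for z using cmod_coords[of z] by (simp add: tn)
  define A :: "4 \<Rightarrow> int" where "A = ($) (vector [0, 0, 0, 1] :: int ^ 4)"
  define B :: "4 \<Rightarrow> int" where "B = ($) (vector [1, 0, 0, 0] :: int ^ 4)"
  define C :: "4 \<Rightarrow> int" where "C = ($) (vector [-1, 1, 0, -1] :: int ^ 4)"
  define D :: "4 \<Rightarrow> int" where "D = ($) (vector [-1, 0, 1, -1] :: int ^ 4)"
  define N :: "real ^ 4" where "N = vector [0, 0, 0, 1]"
  note defs = A_def B_def C_def D_def
  have conf: "conf (-1) (-1) z = (u z)\<^sup>2 + u z * v z + (v z)\<^sup>2 + 1 - u z - v z" for z
    by (simp add: conf_def norm)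
  have low: "1 / 4 * (1 + (cmod z)\<^sup>2) \<le> conf (-1) (-1) z" for z
  proof -
    have "conf (-1) (-1) z - 1 / 4 * (1 + (cmod z)\<^sup>2) =
        9 / 16 * (u z + v z - 8 / 9)\<^sup>2 + 3 / 16 * (u z - v z)\<^sup>2 + 11 / 36"
      unfolding conf norm by (simp add: power2_eq_square algebra_simps)
    then show ?thesis
      using zero_le_power2[of "u z + v z - 8 / 9"] zero_le_power2[of "u z - v z"] by linarith
  qed
  have pos: "conf (-1) (-1) z > 0" for z by (rule less_le_trans[OF _ low]) (simp add: add_pos_nonneg)
  have isom: "of_int 1 * conf (-1) (-1) z * conf (-1) (-1) w
        - (\<Sum>i\<in>UNIV. coord (A i) (B i) (C i) (D i) z * coord (A i) (B i) (C i) (D i) w) = (cmod (z - w))\<^sup>2" for z w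
    unfolding sum_4 coord_def conf norm by (simp add: defs power2_eq_square algebra_simps)
  show ?thesis
  proof (rule lagrange_spectrum_sphere[where A = A and B = B and C = C and D = D and N = N and m = "1 / 4"
        and r = "-1" and s = "-1" and \<kappa> = 1, OF _ low isom])
    show "N \<in> sphere_III" "N \<in> rational_points"
      unfolding N_def sphere_III_def rational_points_def zero_4 by (simp_all add: forall_4)
    show "(\<chi> i. coord (A i) (B i) (C i) (D i) z / conf (-1) (-1) z) \<in> sphere_III - {N}" for z
    proof -
      have "coord (A 4) (B 4) (C 4) (D 4) z / conf (-1) (-1) z \<noteq> 1"
        using pos[of z] by (simp add: coord_def defs conf norm)
      moreover have "coord (A 4) (B 4) (C 4) (D 4) z + coord (A 1) (B 1) (C 1) (D 1) z
          + coord (A 2) (B 2) (C 2) (D 2) z + coord (A 3) (B 3) (C 3) (D 3) z = conf (-1) (-1) z"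
        by (simp add: coord_def defs conf norm)
      moreover have "(coord (A 4) (B 4) (C 4) (D 4) z)\<^sup>2 + (coord (A 1) (B 1) (C 1) (D 1) z)\<^sup>2
          + (coord (A 2) (B 2) (C 2) (D 2) z)\<^sup>2 + (coord (A 3) (B 3) (C 3) (D 3) z)\<^sup>2 = (conf (-1) (-1) z)\<^sup>2"
        using isom[of z z] by (simp add: sum_4 power2_eq_square)
      ultimately show ?thesis using pos[of z] unfolding sphere_III_def N_def zero_4
        by (simp add: vec_eq_iff forall_4 power_divide add_divide_distrib[symmetric])
    qed
    fix x assume x: "x \<in> sphere_III - {N}"
    have lin: "x $ 4 + x $ 1 + x $ 2 + x $ 3 = 1"
      and sph: "(x $ 4)\<^sup>2 + (x $ 1)\<^sup>2 + (x $ 2)\<^sup>2 + (x $ 3)\<^sup>2 = 1"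
      using x unfolding sphere_III_def zero_4 by simp_all
    \<comment> \<open>As before \<open>e\<close> is the reciprocal of \<open>conf\<close>. The
      numerators with index 2 and 3 are the coordinates \<open>u\<close> and \<open>v\<close>
      themselves, whence \<open>a\<close> and \<open>b\<close>.\<close>
    define e where "e = 1 - x $ 4"
    have e: "e \<noteq> 0"
    proof
      assume "e = 0"
      then have x4: "x $ 4 = 1" by (simp add: e_def)
      then have "(x $ 1)\<^sup>2 + (x $ 2)\<^sup>2 + (x $ 3)\<^sup>2 = 0"
        using sph by simp
      then have "x $ 1 = 0" "x $ 2 = 0" "x $ 3 = 0"
        by (simp_all add: add_nonneg_eq_0_iff)
      then have "x = N" using x4 by (simp add: vec_eq_iff forall_4 N_def)
      then show False using x by simp
    qed
    define a where "a = x $ 2 / e"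
    define b where "b = x $ 3 / e"
    define z where "z = of_real a + of_real b * \<omega>"
    have uv: "u z = a" "v z = b" unfolding z_def by simp_all
    have ae: "e * a = x $ 2" and be: "e * b = x $ 3"
      using e by (simp_all add: a_def b_def)
    have x4: "x $ 4 = 1 - e" and x1: "x $ 1 = e - e * a - e * b"
      using lin ae be by (simp_all add: e_def)
    have "2 * (e * (e * (a\<^sup>2 + a * b + b\<^sup>2))) = 2 * (e * (1 - x $ 1))"
      using sph unfolding x1 x4 ae[symmetric] be[symmetric] by (simp add: power2_eq_square algebra_simps)
    then have ab: "e * (a\<^sup>2 + a * b + b\<^sup>2) = 1 - x $ 1" using e by simp
    have h: "e * conf (-1) (-1) z = 1"
      unfolding conf uv using ab ae be lin e_def by algebra
    have x_eq: "x $ 4 = (a\<^sup>2 + a * b + b\<^sup>2 - a - b) * e" "x $ 1 = (1 - a - b) * e" "x $ 2 = a * e" "x $ 3 = b * e"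
      using ab ae be lin e_def by algebra+
    have "x $ i = coord (A i) (B i) (C i) (D i) z / conf (-1) (-1) z" for i
    proof -
      have "x $ i = coord (A i) (B i) (C i) (D i) z * e" for i
        using exhaust_4[of i] by (auto simp: coord_def defs uv norm x_eq)
      then show ?thesis using h pos[of z] by (simp add: field_simps)
    qed
    moreover have "z \<in> K" if "x \<in> rational_points"
      using that unfolding field_iff uv a_def b_def e_def by (auto simp: rational_points_def)
    ultimately show "\<exists>z. (\<chi> i. coord (A i) (B i) (C i) (D i) z / conf (-1) (-1) z) = x \<and>
        (x \<in> rational_points \<longrightarrow> z \<in> K)"
      by (intro exI[of _ z]) (simp add: vec_eq_iff)
  next
    fix l a b c d :: int
    assume dvd: "\<And>i. l dvd A i * a + B i * b + C i * c + D i * d"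
    \<comment> \<open>Here \<open>c\<close> and \<open>d\<close> are themselves entries of the
      numerator vector, so \<open>a\<close> and \<open>b\<close> follow linearly from the other
      two.\<close>
    have p: "l dvd a - c - d" "l dvd b - c - d" "l dvd c" "l dvd d"
      using dvd[of 4] dvd[of 1] dvd[of 2] dvd[of 3] by (simp_all add: defs)
    have "l dvd a" "l dvd b"
      using dvd_add[OF p(1) dvd_add[OF p(3,4)]] dvd_add[OF p(2) dvd_add[OF p(3,4)]] by simp_all
    then show "l dvd a \<and> l dvd b \<and> l dvd 2 * c + t * d \<and> l dvd t * c + (t * t - 2 * n) * d"
      using p by (simp add: tn)
  qed simp
qed

end

theorem corollary1p4:
  "lagrange_spectrum sphere_I (sphere_I \<inter> rational_points) rational_height =
     scale_set (1 / sqrt 2)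
       (lagrange_spectrum UNIV (quadratic_field (-1)) (field_height (quadratic_field (-1)))) \<and>
   lagrange_spectrum sphere_II (sphere_II \<inter> rational_points) rational_height =
     scale_set (1 / sqrt 2)
       (lagrange_spectrum UNIV (quadratic_field (-2)) (field_height (quadratic_field (-2)))) \<and>
   lagrange_spectrum sphere_III (sphere_III \<inter> rational_points) rational_height =
     scale_set (1 / sqrt 2)
       (lagrange_spectrum UNIV (quadratic_field (-3)) (field_height (quadratic_field (-3))))"
  using euclidean_quadratic.lagrange_spectrum_sphere_I[OF euclidean_quadratic_sqrt[of "-1"]]
    euclidean_quadratic.lagrange_spectrum_sphere_II[OF euclidean_quadratic_sqrt[of "-2"]]
    euclidean_quadratic.lagrange_spectrum_sphere_III[OF euclidean_quadratic_eisenstein]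
  by simp

end
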